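(* Let $a>0$ and $b:=a/2$. Let $f_1,f_2\in L^1(\mathbb{R}^2)$ be continuous functions. Then $$f_1\circledast f_2(r,\theta)=\sum_{m=-\infty}^\infty\ \sum_{\{n:\,|m|\le n,\ n-|m|\text{ even}\}}C_{n,m}^{a}(f_1\circledast f_2)\,V_{nm}^a(r,\theta),$$ with equality (convergence of the series) in $L^2(\mathbb{B}_a^2)$, where $$C_{n,m}^a(f_1\circledast f_2)=\sum_{\mathbf{k}\in\mathbb{Z}^2}c_a(\mathbf{k};n,m)\,\widehat{f_1}[\mathbf{k}]\,\widehat{f_2}[\mathbf{k}],$$ and, for $j\in\{1,2\}$ and $\mathbf{k}=(k_1,k_2)^T\in\mathbb{Z}^2$, $\widehat{f_j}[\mathbf{k}]:=\int_0^b\int_0^{2\pi}f_j(r,\theta)e^{-\pi \mathrm{i} a^{-1}r(k_1\cos\theta+k_2\sin\theta)}\,r\,d\theta\,dr$.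
   Context: $\mathbb{B}_a^2=\{\mathbf{x}\in\mathbb{R}^2:\|\mathbf{x}\|_2\le a\}$. For continuous $f_j$, let $R(f_j)$ be the restriction of $f_j$ to $\mathbb{B}_b^2$ and $E(f_j)$ the extension of $R(f_j)$ by zero (equal to $f_j$ on $\mathbb{B}_b^2$ and $0$ elsewhere, on $\Omega_a=[-a,a]^2$ and on all of $\mathbb{R}^2$). The windowed convolution is $f_1\circledast f_2:=E(f_1)\ast E(f_2)$, where $g_1\ast g_2(\mathbf{x})=\int_{\mathbb{R}^2}g_1(\mathbf{y})g_2(\mathbf{x}-\mathbf{y})\,d\mathbf{y}$; it is supported in $\mathbb{B}_a^2$. $f(r,\theta)$ denotes $f$ in polar coordinates. $J_q$ is the Bessel function of the first kind of integer order $q$. For $m\in\mathbb{Z}$ and an integer $n\ge|m|$ with $n-|m|$ even, $$Z_{nm}(r)=\sum_{j=0}^{\frac{n-|m|}{2}}(-1)^j\frac{(n-j)!}{j!\,(\frac{n+|m|}{2}-j)!\,(\frac{n-|m|}{2}-j)!}r^{n-2j},\qquad V_{nm}^a(r,\theta)=a^{-1}\sqrt{\tfrac{n+1}{\pi}}\,Z_{nm}(a^{-1}r)\,e^{\mathrm{i} m\theta},$$ and $C_{n,m}^a(f)=\int_0^a\int_0^{2\pi}f(r,\theta)\overline{V_{nm}^a(r,\theta)}\,r\,d\theta\,dr$. For $\mathbf{k}=(k_1,k_2)^T\in\mathbb{Z}^2$, $|\mathbf{k}|=\sqrt{k_1^2+k_2^2}$, $\Phi(\mathbf{k})\in[0,2\pi)$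 is the polar angle ($k_1=|\mathbf{k}|\cos\Phi(\mathbf{k})$, $k_2=|\mathbf{k}|\sin\Phi(\mathbf{k})$, with $\Phi(\mathbf{0})=0$), and $$c_a(\mathbf{k};n,m)=\sqrt{n+1}\,\frac{\mathrm{i}^m(-1)^{\frac{n-m}{2}}J_{n+1}(\pi|\mathbf{k}|)}{2a\sqrt{\pi}\,|\mathbf{k}|}\,e^{-\mathrm{i} m\Phi(\mathbf{k})},$$ where at $\mathbf{k}=\mathbf{0}$ the quotient $J_{n+1}(\pi|\mathbf{k}|)/|\mathbf{k}|$ is understood as its limit as $|\mathbf{k}|\to0$ ($\pi/2$ if $n=0$, $0$ if $n\ge1$). *)

theory Defs
  imports "HOL-Analysis.Analysis"
begin

text \<open>
  The plane is \<^typ>\<open>real \<times> real\<close>; its library norm is the Euclidean one and \<^const>\<open>lborel\<close>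
  on it is planar Lebesgue measure (restricted to Borel sets). Functions are complex-valued.
\<close>

definition polar :: "(real \<times> real \<Rightarrow> complex) \<Rightarrow> real \<Rightarrow> real \<Rightarrow> complex" where
  "polar f r \<theta> = f (r * cos \<theta>, r * sin \<theta>)"

text \<open>\<^const>\<open>Arg2pi\<close> takes values in $[0, 2\pi)$ and is \<open>0\<close> at the origin.\<close>

definition polar_angle :: "real \<times> real \<Rightarrow> real" where
  "polar_angle x = Arg2pi (Complex (fst x) (snd x))"

definition zero_extension :: "real \<Rightarrow> (real \<times> real \<Rightarrow> complex) \<Rightarrow> real \<times> real \<Rightarrow> complex" where
  "zero_extension b f = (\<lambda>x. if x \<in> cball 0 b then f x else 0)"

definition convolution ::
  "(real \<times> real \<Rightarrow> complex) \<Rightarrow> (real \<times> real \<Rightarrow> complex) \<Rightarrow> real \<times> real \<Rightarrow> complex" where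
  "convolution g\<^sub>1 g\<^sub>2 = (\<lambda>x. \<integral>y. g\<^sub>1 y * g\<^sub>2 (x - y) \<partial>lborel)"

definition windowed_convolution ::
  "real \<Rightarrow> (real \<times> real \<Rightarrow> complex) \<Rightarrow> (real \<times> real \<Rightarrow> complex) \<Rightarrow> real \<times> real \<Rightarrow> complex" where
  "windowed_convolution b f\<^sub>1 f\<^sub>2 = convolution (zero_extension b f\<^sub>1) (zero_extension b f\<^sub>2)"

text \<open>Bessel function of the first kind, for orders \<open>q \<ge> 0\<close> (only orders \<open>n + 1\<close> occur below).\<close>

definition bessel_J :: "nat \<Rightarrow> real \<Rightarrow> real" where
  "bessel_J q x = (\<Sum>j. (- 1) ^ j / (fact j * fact (j + q)) * (x / 2) ^ (2 * j + q))"

definition zernike_indices :: "int \<Rightarrow> nat set" where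
  "zernike_indices m = {n. \<bar>m\<bar> \<le> int n \<and> even (int n - \<bar>m\<bar>)}"

definition zernike_radial :: "nat \<Rightarrow> int \<Rightarrow> real \<Rightarrow> real" where
  "zernike_radial n m r = (let \<mu> = nat \<bar>m\<bar> in
     \<Sum>j = 0..(n - \<mu>) div 2.
       (- 1) ^ j * fact (n - j) /
         (fact j * fact ((n + \<mu>) div 2 - j) * fact ((n - \<mu>) div 2 - j)) * r ^ (n - 2 * j))"

definition zernike :: "real \<Rightarrow> nat \<Rightarrow> int \<Rightarrow> real \<Rightarrow> real \<Rightarrow> complex" where
  "zernike a n m r \<theta> =
     complex_of_real (1 / a * sqrt ((real n + 1) / pi) * zernike_radial n m (r / a))
     * exp (\<i> * of_int m * of_real \<theta>)"

definition zernike_coeff :: "real \<Rightarrow> nat \<Rightarrow> int \<Rightarrow> (real \<times> real \<Rightarrow> complex) \<Rightarrow> complex" where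
  "zernike_coeff a n m f =
     (LBINT r:{0..a}. LBINT \<theta>:{0..2 * pi}. polar f r \<theta> * cnj (zernike a n m r \<theta>) * of_real r)"

definition lattice_point :: "int \<times> int \<Rightarrow> real \<times> real" where
  "lattice_point k = (real_of_int (fst k), real_of_int (snd k))"

text \<open>
  The quotient $J_{n+1}(\pi|k|)/|k|$, with its limit as $|k| \to 0$ as value at \<open>k = 0\<close>.
\<close>

definition bessel_quotient :: "nat \<Rightarrow> int \<times> int \<Rightarrow> real" where
  "bessel_quotient n k =
     (if k = 0 then (if n = 0 then pi / 2 else 0)
      else bessel_J (n + 1) (pi * norm (lattice_point k)) / norm (lattice_point k))"

definition conv_weight :: "real \<Rightarrow> int \<times> int \<Rightarrow> nat \<Rightarrow> int \<Rightarrow> complex" where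
  "conv_weight a k n m =
     of_real (sqrt (real n + 1)) * (\<i> powi m * (- 1) powi ((int n - m) div 2)
        * of_real (bessel_quotient n k)) / of_real (2 * a * sqrt pi)
     * exp (- \<i> * of_int m * of_real (polar_angle (lattice_point k)))"

definition disc_fourier_coeff ::
  "real \<Rightarrow> real \<Rightarrow> (real \<times> real \<Rightarrow> complex) \<Rightarrow> int \<times> int \<Rightarrow> complex" where
  "disc_fourier_coeff a b f k =
     (LBINT r:{0..b}. LBINT \<theta>:{0..2 * pi}. polar f r \<theta>
        * exp (- of_real pi * \<i> * of_real (1 / a * r *
            (real_of_int (fst k) * cos \<theta> + real_of_int (snd k) * sin \<theta>)))
        * of_real r)"

definition in_L2_on :: "(real \<times> real) set \<Rightarrow> (real \<times> real \<Rightarrow> complex) \<Rightarrow> bool" where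
  "in_L2_on S f \<longleftrightarrow> set_borel_measurable lborel S f \<and> set_integrable lborel S (\<lambda>x. (cmod (f x))\<^sup>2)"

definition L2_norm_on :: "(real \<times> real) set \<Rightarrow> (real \<times> real \<Rightarrow> complex) \<Rightarrow> real" where
  "L2_norm_on S f = sqrt (LBINT x:S. (cmod (f x))\<^sup>2)"

text \<open>
  The analogue of \<^const>\<open>has_sum\<close> for convergence in $L^2(S)$: the series \<open>u\<close> indexed by \<open>I\<close>
  converges unconditionally to \<open>F\<close>.
\<close>

definition has_L2_sum ::
  "(real \<times> real) set \<Rightarrow> ('i \<Rightarrow> real \<times> real \<Rightarrow> complex) \<Rightarrow> 'i set \<Rightarrow> (real \<times> real \<Rightarrow> complex) \<Rightarrow> bool"
  where
  "has_L2_sum S u I F \<longleftrightarrow>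
     (\<forall>i\<in>I. in_L2_on S (u i)) \<and> in_L2_on S F \<and>
     ((\<lambda>A. L2_norm_on S (\<lambda>x. F x - (\<Sum>i\<in>A. u i x))) \<longlongrightarrow> 0) (finite_subsets_at_top I)"

end

theory Submission
  imports Defs
begin

text \<open>
  Let \<open>F\<close> be the windowed convolution. It is continuous and vanishes off the open disc of radius
  \<open>a\<close>, because each factor lives in the disc of radius \<open>b = a / 2\<close>. Two orthonormal systems are
  played off against each other: the Zernike functions on the disc, and the exponentials
  \<open>(2 a)\<^sup>-\<^sup>1 exp (i \<pi> k \<bullet> x / a)\<close> on the circumscribed square.

  The Zernike functions are polynomials in \<open>z = x + i y\<close> and its conjugate. Everything
  about them follows from one family of moments, the integrals of \<open>r\<^sup>N e\<^sup>i\<^sup>m\<^sup>\<theta>\<close> against them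
  with \<open>N - \<bar>m\<bar>\<close> even and nonnegative (\<open>zernike_moment\<close>). The moments
  vanish for \<open>N < n\<close>, which gives orthogonality; the moment with \<open>N = n\<close> gives the
  normalisation. Since each Zernike function has a nonzero leading coefficient,
  all monomials lie in their span, and Stone--Weierstrass makes the system complete for continuous
  functions (\<open>zernike_complete\<close>).

  Completeness drives both sums of the expansion. The inner sum over \<open>n\<close> converges to the
  angular component of \<open>F\<close> of frequency \<open>m\<close>: that component is again continuous, its
  coefficients are those of \<open>F\<close> for this \<open>m\<close> and zero otherwise, so completeness applies to it
  (\<open>zernike_inner_sum\<close>). The outer sum over \<open>m\<close> converges because the remainder after
  finitely many angular components has coefficients dominated by those of the remainder of a
  finite Zernike sum, and by completeness the coefficients control the norm
  (\<open>zernike_outer_sum\<close>).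

  For the coefficient formula, \<open>F\<close> vanishes on the boundary of the square, so it lifts to a
  continuous function on the torus and its Fourier series converges to it in \<open>L\<^sup>2\<close> of the square
  (\<open>fourier_complete\<close>). Taking an inner product over the disc is \<open>L\<^sup>2\<close>-continuous, so the Zernike
  coefficient of \<open>F\<close> is the unconditional sum of its Fourier coefficients times the Zernike
  coefficients of the plane waves. The former are products by the convolution theorem
  (\<open>convolution_theorem\<close>). The latter come from the exponential series of the plane wave: integrated
  against a Zernike function, only the terms surviving in the moment formula remain, and they add up
  to the series of \<open>J\<^sub>n\<^sub>+\<^sub>1\<close> (\<open>plane_wave_zernike\<close>).

  All functions that are expanded are continuous on a compact set, so the Hilbert space theory is developed
  only for such functions.
\<close>

section \<open>Orthonormal expansions of continuous functions\<close>

definition inner_on :: "(real \<times> real) set \<Rightarrow> (real \<times> real \<Rightarrow> complex) \<Rightarrow> (real \<times> real \<Rightarrow> complex) \<Rightarrow> complex" where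
  "inner_on S f g = (LBINT x:S. f x * cnj (g x))"

lemma set_integrable_continuous_compact:
  fixes f :: "'a::euclidean_space \<Rightarrow> 'b::{banach, second_countable_topology}"
  assumes "compact S" "continuous_on S f"
  shows "set_integrable lborel S f"
  using borel_integrable_compact[OF assms] by (simp add: set_integrable_def)

lemma set_integral_sum_finite:
  fixes f :: "'i \<Rightarrow> 'a \<Rightarrow> 'b::{banach, second_countable_topology}"
  assumes "\<And>i. i \<in> A \<Longrightarrow> set_integrable M S (f i)"
  shows "(LINT x:S|M. (\<Sum>i\<in>A. f i x)) = (\<Sum>i\<in>A. LINT x:S|M. f i x)"
  using assms by (simp add: set_lebesgue_integral_def set_integrable_def scaleR_sum_right)

lemma inner_on_continuous_integrable:
  assumes "compact S" "continuous_on S f" "continuous_on S g"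
  shows "set_integrable lborel S (\<lambda>x. f x * cnj (g x))"
  using assms by (intro set_integrable_continuous_compact continuous_intros)

lemma inner_on_diff_left:
  assumes "compact S" "continuous_on S f" "continuous_on S g" "continuous_on S h"
  shows "inner_on S (\<lambda>x. f x - g x) h = inner_on S f h - inner_on S g h"
  using assms by (simp add: inner_on_def left_diff_distrib inner_on_continuous_integrable)

lemma inner_on_scale_left: "inner_on S (\<lambda>x. c * f x) g = c * inner_on S f g"
  by (simp add: inner_on_def mult.assoc)

lemma inner_on_add_left:
  assumes "compact S" "continuous_on S f" "continuous_on S g" "continuous_on S h"
  shows "inner_on S (\<lambda>x. f x + g x) h = inner_on S f h + inner_on S g h"
  using assms by (simp add: inner_on_def distrib_right inner_on_continuous_integrable)

lemma inner_on_sum_left: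
  assumes "compact S" "\<And>i. i \<in> A \<Longrightarrow> continuous_on S (f i)" "continuous_on S h"
  shows "inner_on S (\<lambda>x. \<Sum>i\<in>A. f i x) h = (\<Sum>i\<in>A. inner_on S (f i) h)"
  using assms by (simp add: inner_on_def sum_distrib_right set_integral_sum_finite inner_on_continuous_integrable)

lemma inner_on_commute: "inner_on S g f = cnj (inner_on S f g)"
  unfolding inner_on_def set_lebesgue_integral_def
  by (subst Bochner_Integration.integral_cnj[symmetric]) (simp add: scaleR_conv_of_real mult.commute)

lemma L2_norm_on_nonneg: "L2_norm_on S f \<ge> 0"
  by (auto simp: L2_norm_on_def set_lebesgue_integral_def)

lemma L2_norm_on_square: "(L2_norm_on S f)\<^sup>2 = (LBINT x:S. (cmod (f x))\<^sup>2)"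
  unfolding L2_norm_on_def
  by (intro real_sqrt_pow2 Bochner_Integration.integral_nonneg)
     (auto simp: set_lebesgue_integral_def)

lemma inner_on_self: "inner_on S f f = of_real ((L2_norm_on S f)\<^sup>2)"
  unfolding L2_norm_on_square inner_on_def
  by (simp add: complex_norm_square set_integral_complex_of_real[symmetric] del: of_real_power
      flip: complex_norm_square)

lemma L2_norm_on_le_sup:
  assumes S: "compact S" and f: "continuous_on S f" and le: "\<And>x. x \<in> S \<Longrightarrow> cmod (f x) \<le> \<epsilon>"
    and "\<epsilon> \<ge> 0"
  shows "L2_norm_on S f \<le> \<epsilon> * sqrt (measure lborel S)"
proof -
  have "(LBINT x:S. (cmod (f x))\<^sup>2) \<le> (LBINT x:S. \<epsilon>\<^sup>2)"
    using S f le by (intro set_integral_mono set_integrable_continuous_compact continuous_intros)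
      (auto intro: power_mono)
  also have "\<dots> = \<epsilon>\<^sup>2 * measure lborel S"
    using S by (simp add: set_lebesgue_integral_def emeasure_compact_finite less_imp_neq borel_compact)
  finally have "L2_norm_on S f \<le> sqrt (\<epsilon>\<^sup>2 * measure lborel S)"
    unfolding L2_norm_on_def by (rule real_sqrt_le_mono)
  then show ?thesis using \<open>\<epsilon> \<ge> 0\<close> by (simp add: real_sqrt_mult)
qed

lemma in_L2_on_continuous:
  assumes "compact S" "continuous_on S f"
  shows "in_L2_on S f"
  unfolding in_L2_on_def
proof
  show "set_borel_measurable lborel S f"
    using set_integrable_continuous_compact[OF assms]
    by (auto simp: set_integrable_def set_borel_measurable_def dest: borel_measurable_integrable)
  show "set_integrable lborel S (\<lambda>x. (cmod (f x))\<^sup>2)"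
    using assms by (intro set_integrable_continuous_compact continuous_intros)
qed

definition orthonormal_on :: "(real \<times> real) set \<Rightarrow> ('i \<Rightarrow> real \<times> real \<Rightarrow> complex) \<Rightarrow> 'i set \<Rightarrow> bool" where
  "orthonormal_on S e I \<longleftrightarrow> (\<forall>i\<in>I. continuous_on S (e i)) \<and>
     (\<forall>i\<in>I. \<forall>j\<in>I. inner_on S (e i) (e j) = (if i = j then 1 else 0))"

definition proj_on ::
  "(real \<times> real) set \<Rightarrow> ('i \<Rightarrow> real \<times> real \<Rightarrow> complex) \<Rightarrow> 'i set \<Rightarrow> (real \<times> real \<Rightarrow> complex) \<Rightarrow> real \<times> real \<Rightarrow> complex" where
  "proj_on S e A f = (\<lambda>x. \<Sum>i\<in>A. inner_on S f (e i) * e i x)"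

context
  fixes S :: "(real \<times> real) set" and e :: "'i \<Rightarrow> real \<times> real \<Rightarrow> complex" and I :: "'i set"
  assumes S: "compact S" and on: "orthonormal_on S e I"
begin

lemma orthonormal_continuous: "i \<in> I \<Longrightarrow> continuous_on S (e i)"
  using on by (auto simp: orthonormal_on_def)

lemma continuous_on_proj: "A \<subseteq> I \<Longrightarrow> continuous_on S (proj_on S e A f)"
  unfolding proj_on_def by (intro continuous_intros orthonormal_continuous) auto

lemma inner_on_proj:
  assumes "finite A" "A \<subseteq> I" "i \<in> I"
  shows "inner_on S (proj_on S e A f) (e i) = (if i \<in> A then inner_on S f (e i) else 0)"
proof -
  have "inner_on S (proj_on S e A f) (e i) = (\<Sum>j\<in>A. inner_on S f (e j) * inner_on S (e j) (e i))"
    unfolding proj_on_def using S assms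
    by (subst inner_on_sum_left) (auto simp: inner_on_scale_left intro!: continuous_intros orthonormal_continuous)
  also have "\<dots> = (\<Sum>j\<in>A. if j = i then inner_on S f (e i) else 0)"
    using on assms by (intro sum.cong) (auto simp: orthonormal_on_def)
  finally show ?thesis using assms by simp
qed

lemma inner_on_proj_right:
  assumes A: "finite A" "A \<subseteq> I" and g: "continuous_on S g"
  shows "inner_on S g (proj_on S e A f) = (\<Sum>i\<in>A. inner_on S g (e i) * cnj (inner_on S f (e i)))"
proof -
  have "inner_on S (proj_on S e A f) g = (\<Sum>j\<in>A. inner_on S f (e j) * inner_on S (e j) g)"
    unfolding proj_on_def using S assms
    by (subst inner_on_sum_left) (auto simp: inner_on_scale_left intro!: continuous_intros orthonormal_continuous)
  then show ?thesis
    by (subst inner_on_commute) (simp add: inner_on_commute[of S _ g] mult.commute)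
qed

text \<open>
  The remainder is orthogonal to every \<open>e i\<close> with \<open>i \<in> A\<close>, hence to the projection itself.
\<close>

lemma Pythagoras:
  assumes A: "finite A" "A \<subseteq> I" and f: "continuous_on S f"
  shows "(L2_norm_on S (\<lambda>x. f x - proj_on S e A f x))\<^sup>2
       = (L2_norm_on S f)\<^sup>2 - (\<Sum>i\<in>A. (cmod (inner_on S f (e i)))\<^sup>2)"
proof -
  let ?g = "\<lambda>x. f x - proj_on S e A f x"
  have g: "continuous_on S ?g" using f A by (intro continuous_intros continuous_on_proj)
  have i: "inner_on S ?g (e i) = 0" if "i \<in> A" for i
  proof -
    have "i \<in> I" using that A by auto
    then have "inner_on S ?g (e i) = inner_on S f (e i) - inner_on S (proj_on S e A f) (e i)"
      using S f A by (intro inner_on_diff_left continuous_on_proj orthonormal_continuous)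
    then show ?thesis using inner_on_proj[OF A \<open>i \<in> I\<close>, of f] that by simp
  qed
  have "inner_on S ?g ?g = inner_on S ?g f - inner_on S ?g (proj_on S e A f)"
    using inner_on_diff_left[OF S f continuous_on_proj[OF A(2)] g, of f]
    by (metis (no_types, lifting) inner_on_commute complex_cnj_cancel_iff complex_cnj_diff)
  also have "inner_on S ?g (proj_on S e A f) = 0"
    by (subst inner_on_proj_right) (use A g i in auto)
  also have "inner_on S ?g f = inner_on S f f - inner_on S (proj_on S e A f) f"
    using f A by (intro inner_on_diff_left S continuous_on_proj)
  also have "inner_on S (proj_on S e A f) f = (\<Sum>i\<in>A. of_real ((cmod (inner_on S f (e i)))\<^sup>2))"
    by (subst inner_on_commute, subst inner_on_proj_right)
       (use A f in \<open>auto simp: complex_norm_square mult.commute simp del: of_real_power\<close>)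
  finally have "complex_of_real ((L2_norm_on S ?g)\<^sup>2) =
      of_real ((L2_norm_on S f)\<^sup>2 - (\<Sum>i\<in>A. (cmod (inner_on S f (e i)))\<^sup>2))"
    by (simp only: inner_on_self of_real_diff of_real_sum diff_zero)
  then show ?thesis by (simp only: of_real_eq_iff)
qed

lemma Bessel:
  assumes "finite A" "A \<subseteq> I" "continuous_on S f"
  shows "(\<Sum>i\<in>A. (cmod (inner_on S f (e i)))\<^sup>2) \<le> (L2_norm_on S f)\<^sup>2"
  using Pythagoras[OF assms] zero_le_power2[of "L2_norm_on S (\<lambda>x. f x - proj_on S e A f x)"]
  by linarith

text \<open>
  This replaces the triangle inequality below: the remainder of \<open>f\<close> equals the remainder
  of \<open>f - p\<close> as soon as \<open>p\<close> is reproduced by the projection, so it is at most as large as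
  \<open>f - p\<close>.
\<close>

lemma proj_contraction:
  assumes "finite A" "A \<subseteq> I" "continuous_on S f"
  shows "L2_norm_on S (\<lambda>x. f x - proj_on S e A f x) \<le> L2_norm_on S f"
proof (rule power2_le_imp_le[OF _ L2_norm_on_nonneg])
  show "(L2_norm_on S (\<lambda>x. f x - proj_on S e A f x))\<^sup>2 \<le> (L2_norm_on S f)\<^sup>2"
    using sum_nonneg[of A "\<lambda>i. (cmod (inner_on S f (e i)))\<^sup>2"] unfolding Pythagoras[OF assms] by simp
qed

end

text \<open>
  The complex linear span. The inductive form lets closure properties be proved generator
  by generator, without handling finite combinations.
\<close>

inductive_set cspan :: "('b \<Rightarrow> complex) set \<Rightarrow> ('b \<Rightarrow> complex) set" for G where
  zero: "(\<lambda>x. 0) \<in> cspan G"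
| base: "g \<in> G \<Longrightarrow> g \<in> cspan G"
| scale: "f \<in> cspan G \<Longrightarrow> (\<lambda>x. c * f x) \<in> cspan G"
| add: "f \<in> cspan G \<Longrightarrow> g \<in> cspan G \<Longrightarrow> (\<lambda>x. f x + g x) \<in> cspan G"

lemma cspan_sum: "(\<And>i. i \<in> A \<Longrightarrow> f i \<in> cspan G) \<Longrightarrow> (\<lambda>x. \<Sum>i\<in>A. f i x) \<in> cspan G"
  by (induction A rule: infinite_finite_induct) (simp_all add: cspan.zero cspan.add)

lemma cspan_cspan: "f \<in> cspan G \<Longrightarrow> G \<subseteq> cspan H \<Longrightarrow> f \<in> cspan H"
  by (induction rule: cspan.induct) (auto simp: cspan.zero cspan.scale cspan.add)

text \<open>
  Bilinearity reduces the claim to generators. This is what turns the span of characters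
  or monomials into an algebra.
\<close>

lemma cspan_mult:
  assumes G: "\<And>g h. g \<in> G \<Longrightarrow> h \<in> G \<Longrightarrow> (\<lambda>x. g x * h x) \<in> cspan G"
    and f: "f \<in> cspan G" and h: "h \<in> cspan G"
  shows "(\<lambda>x. f x * h x) \<in> cspan G"
  using f
proof induction
  case (base g)
  from h show ?case
  proof induction
    case zero
    show ?case by (simp add: cspan.zero)
  next
    case (base h)
    then show ?case by (rule G[OF \<open>g \<in> G\<close>])
  next
    case (scale f c)
    from cspan.scale[OF scale.IH, of c] show ?case by (simp add: mult_ac)
  next
    case (add f f')
    from cspan.add[OF add.IH] show ?case by (simp add: distrib_left)
  qed
next
  case zero
  show ?case by (simp add: cspan.zero)
next
  case (scale f c)
  from cspan.scale[OF scale.IH, of c] show ?case by (simp add: mult_ac)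
next
  case (add f f')
  from cspan.add[OF add.IH] show ?case by (simp add: distrib_right)
qed

lemma cspan_continuous_on:
  "f \<in> cspan G \<Longrightarrow> (\<And>g. g \<in> G \<Longrightarrow> continuous_on S g) \<Longrightarrow> continuous_on S f"
  by (induction rule: cspan.induct) (auto intro!: continuous_intros)

text \<open>
  By induction on the polynomial: a linear functional is a combination of coordinates, and
  the span is closed under sums and products.
\<close>

lemma real_polynomial_in_algebra:
  fixes T :: "'b \<Rightarrow> 'a::euclidean_space"
  assumes q: "real_polynomial_function q"
    and const: "\<And>c. (\<lambda>x. c) \<in> cspan G"
    and mult: "\<And>g h. g \<in> G \<Longrightarrow> h \<in> G \<Longrightarrow> (\<lambda>x. g x * h x) \<in> cspan G"
    and coord: "\<And>v. v \<in> Basis \<Longrightarrow> (\<lambda>x. of_real (T x \<bullet> v)) \<in> cspan G"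
  shows "(\<lambda>x. complex_of_real (q (T x))) \<in> cspan G"
  using q
proof induction
  case (linear f)
  have f_eq: "f y = (\<Sum>v\<in>Basis. (y \<bullet> v) * f v)" for y
  proof -
    interpret bounded_linear f by fact
    have "f (\<Sum>v\<in>Basis. (y \<bullet> v) *\<^sub>R v) = (\<Sum>v\<in>Basis. (y \<bullet> v) * f v)"
      by (simp add: sum scaleR)
    then show ?thesis by (simp only: euclidean_representation)
  qed
  have "(\<lambda>x. complex_of_real (f (T x)))
      = (\<lambda>x. \<Sum>v\<in>Basis. of_real (f v) * of_real (T x \<bullet> v))"
    unfolding f_eq[of "T _"] of_real_sum of_real_mult by (simp only: mult.commute)
  also have "\<dots> \<in> cspan G" by (intro cspan_sum cspan.scale coord)
  finally show ?case .
next
  case (add f g)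
  from cspan.add[OF add.IH] show ?case by simp
next
  case (mult f g)
  show ?case unfolding of_real_mult by (rule cspan_mult[OF _ mult.IH]) (rule assms(3))
qed (rule const)

text \<open>
  The map \<open>T\<close> is the identity for monomials on the disc and the covering of the torus for
  trigonometric polynomials on the square; in both cases the polynomial approximation of
  \<open>H\<close> on the image is pulled back along \<open>T\<close>.
\<close>

lemma Stone_Weierstrass_cspan:
  fixes T :: "'b \<Rightarrow> 'a::euclidean_space" and H :: "'a \<Rightarrow> complex"
  assumes "compact (T ` S)" "continuous_on (T ` S) H" "\<epsilon> > 0"
    and G: "\<And>c. (\<lambda>x. c) \<in> cspan G"
      "\<And>g h. g \<in> G \<Longrightarrow> h \<in> G \<Longrightarrow> (\<lambda>x. g x * h x) \<in> cspan G"
      "\<And>v. v \<in> Basis \<Longrightarrow> (\<lambda>x. of_real (T x \<bullet> v)) \<in> cspan G"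
  obtains p where "p \<in> cspan G" "\<And>x. x \<in> S \<Longrightarrow> cmod (H (T x) - p x) < \<epsilon>"
proof -
  obtain g where g: "polynomial_function g" "\<forall>x \<in> T ` S. norm (H x - g x) < \<epsilon>"
    using Stone_Weierstrass_polynomial_function[OF assms(1-3)] by blast
  have "real_polynomial_function (Re \<circ> g)" "real_polynomial_function (Im \<circ> g)"
    using g(1) bounded_linear_Re bounded_linear_Im by (auto simp: polynomial_function_def)
  then have "(\<lambda>x. complex_of_real ((Re \<circ> g) (T x))) \<in> cspan G"
      "(\<lambda>x. complex_of_real ((Im \<circ> g) (T x))) \<in> cspan G"
    using real_polynomial_in_algebra[of _ G T, OF _ G] by blast+
  then have "(\<lambda>x. of_real (Re (g (T x))) + \<i> * of_real (Im (g (T x)))) \<in> cspan G"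
    unfolding o_def by (intro cspan.add cspan.scale)
  then have "(\<lambda>x. g (T x)) \<in> cspan G" by (simp flip: complex_eq)
  then show ?thesis using that g(2) by blast
qed

text \<open>
  A finite combination of the \<open>e i\<close> is its own projection once \<open>A\<close> contains all indices
  that occur in it.
\<close>

lemma proj_cspan_eventually_id:
  assumes S: "compact S" and on: "orthonormal_on S e I" and f: "f \<in> cspan (e ` I)"
  shows "\<exists>A0. finite A0 \<and> A0 \<subseteq> I \<and>
    (\<forall>A. finite A \<longrightarrow> A0 \<subseteq> A \<longrightarrow> A \<subseteq> I \<longrightarrow> (\<forall>x. proj_on S e A f x = f x))"
  using f
proof induction
  case zero
  show ?case by (intro exI[of _ "{}"]) (auto simp: proj_on_def inner_on_def)
next
  case (base g)
  then obtain i where i: "i \<in> I" "g = e i" by auto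
  show ?case
  proof (intro exI[of _ "{i}"] conjI allI impI)
    fix A x assume A: "finite A" "{i} \<subseteq> A" "A \<subseteq> I"
    have "proj_on S e A g x = (\<Sum>j\<in>A. if j = i then e i x else 0)"
      unfolding proj_on_def using i A on by (intro sum.cong) (auto simp: orthonormal_on_def)
    then show "proj_on S e A g x = g x" using A i by simp
  qed (use i in auto)
next
  case (scale f c)
  moreover have "proj_on S e A (\<lambda>x. c * f x) x = c * proj_on S e A f x" for A x
    by (simp add: proj_on_def inner_on_scale_left mult.assoc sum_distrib_left)
  ultimately show ?case by (metis (no_types, lifting))
next
  case (add f g)
  then obtain A0 A1 where A: "finite A0" "A0 \<subseteq> I" "finite A1" "A1 \<subseteq> I"
    "\<And>A x. finite A \<Longrightarrow> A0 \<subseteq> A \<Longrightarrow> A \<subseteq> I \<Longrightarrow> proj_on S e A f x = f x"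
    "\<And>A x. finite A \<Longrightarrow> A1 \<subseteq> A \<Longrightarrow> A \<subseteq> I \<Longrightarrow> proj_on S e A g x = g x" by metis
  have cont: "continuous_on S f" "continuous_on S g"
    by (rule cspan_continuous_on[OF add.hyps(1)] cspan_continuous_on[OF add.hyps(2)],
        use on in \<open>auto simp: orthonormal_on_def\<close>)+
  show ?case
  proof (intro exI[of _ "A0 \<union> A1"] conjI allI impI)
    fix A x assume *: "finite A" "A0 \<union> A1 \<subseteq> A" "A \<subseteq> I"
    have "proj_on S e A (\<lambda>x. f x + g x) x = proj_on S e A f x + proj_on S e A g x"
      unfolding proj_on_def sum.distrib[symmetric] using * cont S on
      by (intro sum.cong refl, subst inner_on_add_left) (auto simp: distrib_right orthonormal_on_def)
    then show "proj_on S e A (\<lambda>x. f x + g x) x = f x + g x" using A * by simp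
  qed (use A in auto)
qed

definition approximable_on :: "(real \<times> real) set \<Rightarrow> (real \<times> real \<Rightarrow> complex) set \<Rightarrow> (real \<times> real \<Rightarrow> complex) \<Rightarrow> bool" where
  "approximable_on S G f \<longleftrightarrow> (\<forall>\<epsilon>>0. \<exists>p\<in>cspan G. \<forall>x\<in>S. cmod (f x - p x) < \<epsilon>)"

text \<open>
  Approximate \<open>f\<close> uniformly by \<open>p\<close> in the span. Once \<open>A\<close> reproduces \<open>p\<close>, the remainder of
  \<open>f\<close> is the remainder of \<open>f - p\<close>, which is no larger than \<open>f - p\<close>.
\<close>

lemma proj_converges:
  assumes S: "compact S" and on: "orthonormal_on S e I"
    and f: "continuous_on S f" "approximable_on S (e ` I) f" and "\<epsilon> > 0"
  obtains A0 where "finite A0" "A0 \<subseteq> I"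
    "\<And>A. finite A \<Longrightarrow> A0 \<subseteq> A \<Longrightarrow> A \<subseteq> I \<Longrightarrow> L2_norm_on S (\<lambda>x. f x - proj_on S e A f x) < \<epsilon>"
proof -
  \<comment> \<open>The added \<open>1\<close> covers sets of measure zero.\<close>
  define \<delta> where "\<delta> = \<epsilon> / (sqrt (measure lborel S) + 1)"
  have sq: "sqrt (measure lborel S) \<ge> 0" by simp
  then have \<delta>: "\<delta> > 0" using \<open>\<epsilon> > 0\<close> unfolding \<delta>_def by (intro divide_pos_pos) linarith+
  obtain p where p: "p \<in> cspan (e ` I)" "\<forall>x\<in>S. cmod (f x - p x) < \<delta>"
    using f(2)[unfolded approximable_on_def, rule_format, OF \<delta>] by blast
  have pc: "continuous_on S p"
    by (rule cspan_continuous_on[OF p(1)]) (use on in \<open>auto simp: orthonormal_on_def\<close>)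
  obtain A0 where A0: "finite A0" "A0 \<subseteq> I"
    "\<And>A x. finite A \<Longrightarrow> A0 \<subseteq> A \<Longrightarrow> A \<subseteq> I \<Longrightarrow> proj_on S e A p x = p x"
    using proj_cspan_eventually_id[OF S on p(1)] by metis
  show ?thesis
  proof (rule that[OF A0(1,2)])
    fix A assume A: "finite A" "A0 \<subseteq> A" "A \<subseteq> I"
    let ?d = "\<lambda>x. f x - p x"
    have d: "continuous_on S ?d" using f pc by (intro continuous_intros)
    have "proj_on S e A ?d x = proj_on S e A f x - p x" for x
    proof -
      have "proj_on S e A ?d x = proj_on S e A f x - proj_on S e A p x"
        unfolding proj_on_def sum_subtractf[symmetric] using A f pc S on
        by (intro sum.cong refl, subst inner_on_diff_left) (auto simp: left_diff_distrib orthonormal_on_def)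
      then show ?thesis using A0 A by simp
    qed
    then have "L2_norm_on S (\<lambda>x. f x - proj_on S e A f x)
        = L2_norm_on S (\<lambda>x. ?d x - proj_on S e A ?d x)"
      by simp
    also have "\<dots> \<le> L2_norm_on S ?d" using A d by (intro proj_contraction[OF S on])
    also have "\<dots> \<le> \<delta> * sqrt (measure lborel S)"
      using p(2) \<delta> by (intro L2_norm_on_le_sup S d) auto
    also have "\<dots> < \<epsilon>"
    proof -
      have "sqrt (measure lborel S) / (sqrt (measure lborel S) + 1) < 1" using sq by (intro divide_less_eq_1[THEN iffD2]) linarith
      from mult_strict_left_mono[OF this \<open>\<epsilon> > 0\<close>] show ?thesis by (simp add: \<delta>_def)
    qed
    finally show "L2_norm_on S (\<lambda>x. f x - proj_on S e A f x) < \<epsilon>" .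
  qed
qed

text \<open>
  By completeness the squared norm of \<open>f\<close> is the supremum of the finite sums of squared
  coefficients, and those of \<open>g\<close> never exceed its squared norm.
\<close>

lemma L2_norm_le_by_coefficients:
  assumes S: "compact S" and on: "orthonormal_on S e I"
    and f: "continuous_on S f" "approximable_on S (e ` I) f" and g: "continuous_on S g"
    and le: "\<And>i. i \<in> I \<Longrightarrow> cmod (inner_on S f (e i)) \<le> cmod (inner_on S g (e i))"
  shows "L2_norm_on S f \<le> L2_norm_on S g"
proof (rule power2_le_imp_le[OF _ L2_norm_on_nonneg], rule field_le_epsilon)
  fix \<epsilon> :: real assume "\<epsilon> > 0"
  then obtain A where A: "finite A" "A \<subseteq> I" "L2_norm_on S (\<lambda>x. f x - proj_on S e A f x) < sqrt \<epsilon>"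
    using proj_converges[OF S on f, of "sqrt \<epsilon>"] by (metis order_refl real_sqrt_gt_0_iff)
  have "(L2_norm_on S (\<lambda>x. f x - proj_on S e A f x))\<^sup>2 \<le> \<epsilon>"
    using power_mono[OF less_imp_le[OF A(3)] L2_norm_on_nonneg, of 2] \<open>\<epsilon> > 0\<close> by simp
  then have "(L2_norm_on S f)\<^sup>2 \<le> (\<Sum>i\<in>A. (cmod (inner_on S f (e i)))\<^sup>2) + \<epsilon>"
    unfolding Pythagoras[OF S on A(1,2) f(1)] by simp
  also have "(\<Sum>i\<in>A. (cmod (inner_on S f (e i)))\<^sup>2) \<le> (\<Sum>i\<in>A. (cmod (inner_on S g (e i)))\<^sup>2)"
    using A le by (intro sum_mono power_mono) auto
  also have "\<dots> \<le> (L2_norm_on S g)\<^sup>2" by (rule Bessel[OF S on A(1,2) g])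
  finally show "(L2_norm_on S f)\<^sup>2 \<le> (L2_norm_on S g)\<^sup>2 + \<epsilon>" by simp
qed

section \<open>Polar coordinates in the disc\<close>

lemma Fubini_compact:
  fixes f :: "'a::euclidean_space \<Rightarrow> 'b::euclidean_space \<Rightarrow> complex"
  assumes S: "compact S" and T: "compact T" and f: "continuous_on (S \<times> T) (\<lambda>(x, y). f x y)"
  shows "(LBINT x:S. LBINT y:T. f x y) = (LBINT y:T. LBINT x:S. f x y)"
proof -
  let ?F = "\<lambda>x y. indicator (S \<times> T) (x, y) *\<^sub>R f x y"
  have "integrable lborel (\<lambda>z. indicator (S \<times> T) z *\<^sub>R (case z of (x, y) \<Rightarrow> f x y))"
    by (intro borel_integrable_compact compact_Times S T f)
  then have "integrable (lborel \<Otimes>\<^sub>M lborel) (case_prod ?F)"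
    by (simp add: lborel_prod case_prod_unfold)
  then have "(LBINT y. LBINT x. ?F x y) = (LBINT x. LBINT y. ?F x y)"
    by (rule lborel_pair.Fubini_integral)
  moreover have F: "?F x y = indicator S x *\<^sub>R indicator T y *\<^sub>R f x y" for x y
    by (simp add: indicator_def)
  ultimately have "(LBINT y. LBINT x. indicator T y *\<^sub>R indicator S x *\<^sub>R f x y)
      = (LBINT x. LBINT y. indicator S x *\<^sub>R indicator T y *\<^sub>R f x y)"
    unfolding F by (simp only: scaleR_left_commute)
  then show ?thesis
    by (simp only: set_lebesgue_integral_def Bochner_Integration.integral_scaleR_right)
qed

lemma continuous_on_parametric_integral:
  fixes f :: "'a::topological_space \<Rightarrow> real \<Rightarrow> complex"
  assumes "continuous_on (U \<times> {c..d}) (\<lambda>(x, t). f x t)"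
  shows "continuous_on U (\<lambda>x. LBINT t:{c..d}. f x t)"
proof -
  have "continuous_on U (\<lambda>x. integral (cbox c d) (f x))"
    using assms by (intro integral_continuous_on_param) simp
  moreover have "(LBINT t:{c..d}. f x t) = integral (cbox c d) (f x)" if "x \<in> U" for x
  proof -
    have "continuous_on {c..d} (\<lambda>t. (\<lambda>(x, t). f x t) (x, t))"
      by (rule continuous_on_compose2[OF assms]) (use that in \<open>auto intro!: continuous_intros\<close>)
    then show ?thesis
      by (simp add: set_borel_integral_eq_integral(2) set_integrable_continuous_compact)
  qed
  ultimately show ?thesis by (simp cong: continuous_on_cong)
qed

definition rot :: "real \<Rightarrow> real \<times> real \<Rightarrow> real \<times> real" where
  "rot t x = (cos t * fst x - sin t * snd x, sin t * fst x + cos t * snd x)"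

lemma rot_rot: "rot s (rot t x) = rot (s + t) x"
  by (simp add: rot_def sin_add cos_add algebra_simps)

lemma norm_rot: "norm (rot t x) = norm x"
proof -
  have "(cos t * u - sin t * v)\<^sup>2 + (sin t * u + cos t * v)\<^sup>2 = u\<^sup>2 + v\<^sup>2" for u v :: real
  proof -
    have "(cos t * u - sin t * v)\<^sup>2 + (sin t * u + cos t * v)\<^sup>2 = ((sin t)\<^sup>2 + (cos t)\<^sup>2) * (u\<^sup>2 + v\<^sup>2)"
      by algebra
    then show ?thesis by simp
  qed
  then show ?thesis by (simp add: rot_def norm_prod_def)
qed

lemma continuous_on_rot [continuous_intros]:
  fixes f :: "'a::t2_space \<Rightarrow> real"
  assumes "continuous_on U f" "continuous_on U g"
  shows "continuous_on U (\<lambda>x. rot (f x) (g x))"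
  unfolding rot_def using assms by (auto intro!: continuous_intros)

lemma rot_measurable [measurable]: "rot t \<in> borel_measurable borel"
  by (intro borel_measurable_continuous_onI continuous_intros)

text \<open>Each horizontal line is merely translated.\<close>

lemma lborel_distr_shear_fst:
  "distr lborel borel (\<lambda>z. (fst z + c * snd z, snd z)) = (lborel :: (real \<times> real) measure)"
proof (rule measure_eqI)
  fix A :: "(real \<times> real) set" assume "A \<in> sets (distr lborel borel (\<lambda>z. (fst z + c * snd z, snd z)))"
  then have A [measurable]: "A \<in> sets borel" by simp
  then have [measurable]: "A \<in> sets (borel \<Otimes>\<^sub>M borel)" unfolding borel_prod .
  have "emeasure (distr lborel borel (\<lambda>z. (fst z + c * snd z, snd z))) A
      = (\<integral>\<^sup>+z. indicator A (fst z + c * snd z, snd z) \<partial>lborel)"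
    by (subst nn_integral_indicator[symmetric], simp, subst nn_integral_distr)
       (auto simp: borel_prod[symmetric])
  also have "\<dots> = (\<integral>\<^sup>+z. indicator A (fst z + c * snd z, snd z) \<partial>(lborel \<Otimes>\<^sub>M lborel))"
    by (simp add: lborel_prod)
  also have "\<dots> = (\<integral>\<^sup>+y. \<integral>\<^sup>+x. indicator A (x + c * y, y) \<partial>lborel \<partial>lborel)"
    by (subst lborel_pair.nn_integral_snd[symmetric]) (auto simp: borel_prod)
  also have "\<dots> = (\<integral>\<^sup>+y. \<integral>\<^sup>+x. indicator A (x, y) \<partial>lborel \<partial>lborel)"
  proof (rule nn_integral_cong)
    fix y :: real
    have [measurable]: "(\<lambda>x. (x, y)) \<in> borel_measurable borel"
      by (intro borel_measurable_continuous_onI continuous_intros)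
    have m: "(\<lambda>x. indicator A (x, y) :: ennreal) \<in> borel_measurable borel" by measurable
    have "(\<integral>\<^sup>+x. indicator A (x, y) \<partial>lborel) = (\<integral>\<^sup>+x. indicator A (x, y) \<partial>distr lborel borel ((+) (c * y)))"
      by (simp add: lborel_distr_plus)
    also have "\<dots> = (\<integral>\<^sup>+x. indicator A (x + c * y, y) \<partial>lborel)"
      by (subst nn_integral_distr) (use m in \<open>auto simp: add.commute\<close>)
    finally show "(\<integral>\<^sup>+x. indicator A (x + c * y, y) \<partial>lborel) = (\<integral>\<^sup>+x. indicator A (x, y) \<partial>lborel)" ..
  qed
  also have "\<dots> = (\<integral>\<^sup>+z. indicator A z \<partial>(lborel \<Otimes>\<^sub>M lborel))"
    by (subst lborel_pair.nn_integral_snd[symmetric]) (auto simp: borel_prod)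
  finally show "emeasure (distr lborel borel (\<lambda>z. (fst z + c * snd z, snd z))) A = emeasure lborel A"
    by (simp add: lborel_prod)
qed simp

lemma lborel_distr_swap:
  "distr lborel borel prod.swap = (lborel :: (real \<times> real) measure)"
proof -
  have "distr (lborel \<Otimes>\<^sub>M lborel) (lborel \<Otimes>\<^sub>M lborel) (\<lambda>(x, y). (y, x)) = (lborel \<Otimes>\<^sub>M lborel :: (real \<times> real) measure)"
    by (rule lborel_pair.distr_pair_swap[symmetric])
  moreover have "prod.swap = (\<lambda>(x, y). (y :: real, x :: real))" by auto
  moreover have "distr lborel borel prod.swap = distr lborel lborel (prod.swap :: real \<times> real \<Rightarrow> _)"
    by (rule distr_cong) auto
  ultimately show ?thesis by (simp add: lborel_prod)
qed

lemma lborel_distr_comp: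
  fixes f g :: "real \<times> real \<Rightarrow> real \<times> real"
  assumes "distr lborel borel f = lborel" "distr lborel borel g = lborel"
    and "f \<in> borel_measurable borel" "g \<in> borel_measurable borel"
  shows "distr lborel borel (f \<circ> g) = lborel"
  using assms distr_distr[of f borel borel g lborel] by simp

text \<open>
  A rotation by \<open>t\<close> is a product of three shears with slopes \<open>- tan (t / 2)\<close>, \<open>sin t\<close>,
  \<open>- tan (t / 2)\<close>, each of which preserves area. When \<open>tan (t / 2)\<close> is undefined, rotate
  twice by \<open>t / 2\<close>.
\<close>

lemma lborel_distr_rot: "distr lborel borel (rot t) = lborel"
proof -
  have generic: "distr lborel borel (rot t) = lborel" if c: "cos (t / 2) \<noteq> 0" for t
  proof -
    let ?X = "\<lambda>c z. (fst z + c * snd z, snd z) :: real \<times> real"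
    have X [measurable]: "?X c \<in> borel_measurable borel" for c
      by (intro borel_measurable_continuous_onI continuous_intros)
    have sw [measurable]: "prod.swap \<in> borel_measurable (borel :: (real \<times> real) measure)"
      by (intro borel_measurable_continuous_onI continuous_intros)
    \<comment> \<open>\<open>\<tau>\<close> is \<open>tan (t / 2)\<close>; the two identities in \<open>\<tau>\<close> make the product of shears a rotation.\<close>
    define \<tau> where "\<tau> = sin (t / 2) / cos (t / 2)"
    have "sin t = 2 * sin (t / 2) * cos (t / 2)" "cos t = 2 * (cos (t / 2))\<^sup>2 - 1"
      using sin_double[of "t / 2"] cos_double_cos[of "t / 2"] by simp_all
    moreover have "(sin (t / 2))\<^sup>2 = 1 - (cos (t / 2))\<^sup>2" by (simp add: sin_squared_eq)
    ultimately have \<tau>: "\<tau> * sin t = 1 - cos t" "\<tau> * (1 + cos t) = sin t"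
      using c by (simp_all add: \<tau>_def power2_eq_square)
    have "\<tau> * cos t = sin t - \<tau>" using \<tau>(2) by (simp add: algebra_simps)
    then have \<tau>': "\<tau> * (\<tau> * sin t) = \<tau> - (sin t - \<tau>)"
      unfolding \<tau>(1) by (simp add: algebra_simps)
    have eq: "rot t = ?X (- \<tau>) \<circ> (prod.swap \<circ> (?X (sin t) \<circ> (prod.swap \<circ> ?X (- \<tau>))))"
    proof
      fix z :: "real \<times> real"
      obtain x y where z: "z = (x, y)" by (cases z)
      have "x - \<tau> * y - \<tau> * (y + sin t * (x - \<tau> * y))
          = x - (\<tau> * sin t) * x - 2 * \<tau> * y + \<tau> * (\<tau> * sin t) * y"
        by (simp add: algebra_simps)
      also have "\<dots> = cos t * x - sin t * y" unfolding \<tau>' unfolding \<tau>(1) by (simp add: algebra_simps)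
      finally have 1: "x - \<tau> * y - \<tau> * (y + sin t * (x - \<tau> * y)) = cos t * x - sin t * y" .
      have "y + sin t * (x - \<tau> * y) = y + sin t * x - (\<tau> * sin t) * y"
        by (simp add: algebra_simps)
      also have "\<dots> = sin t * x + cos t * y" unfolding \<tau> by (simp add: algebra_simps)
      finally have 2: "y + sin t * (x - \<tau> * y) = sin t * x + cos t * y" .
      show "rot t z = (?X (- \<tau>) \<circ> (prod.swap \<circ> (?X (sin t) \<circ> (prod.swap \<circ> ?X (- \<tau>))))) z"
        using 1 2 by (simp add: rot_def z)
    qed
    show ?thesis unfolding eq
      by (intro lborel_distr_comp lborel_distr_shear_fst lborel_distr_swap measurable_comp[OF _ X]
          measurable_comp[OF _ sw] X sw)
  qed
  show ?thesis
  proof (cases "cos (t / 2) = 0")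
    case True
    then have "cos (t / 2 / 2) \<noteq> 0"
      using cos_double_cos[of "t / 4"] cos_double[of "t/4"] sin_zero_norm_cos_one[of "t/4"]
      by (auto simp: power2_eq_square)
    from lborel_distr_comp[OF generic[OF this] generic[OF this]]
    have "distr lborel borel (rot (t / 2) \<circ> rot (t / 2)) = lborel" by simp
    moreover have "rot (t / 2) \<circ> rot (t / 2) = rot t" by (auto simp: rot_rot)
    ultimately show ?thesis by simp
  qed (rule generic)
qed

lemma disc_integral_rot:
  fixes f :: "real \<times> real \<Rightarrow> complex"
  assumes f: "continuous_on (cball 0 a) f"
  shows "(LBINT x:cball 0 a. f (rot t x)) = (LBINT x:cball 0 a. f x)"
proof -
  have m: "(\<lambda>x. indicator (cball 0 a) x *\<^sub>R f x) \<in> borel_measurable borel"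
    using borel_integrable_compact[OF compact_cball f] by (auto dest: borel_measurable_integrable)
  have "(LBINT x:cball 0 a. f x) = (\<integral>x. indicator (cball 0 a) x *\<^sub>R f x \<partial>distr lborel borel (rot t))"
    unfolding set_lebesgue_integral_def lborel_distr_rot ..
  also have "\<dots> = (LBINT x. indicator (cball 0 a) (rot t x) *\<^sub>R f (rot t x))"
    by (rule integral_distr) (use m in auto)
  finally show ?thesis by (simp add: set_lebesgue_integral_def indicator_def norm_rot)
qed

text \<open>
  Both measures give \<open>{..x}\<close> the area of the disc of radius \<open>min a x\<close>.
\<close>

lemma distr_norm_disc:
  fixes a :: real
  assumes a: "a > 0"
  shows "distr (density lborel (indicator (cball (0 :: real \<times> real) a))) borel norm
       = density lborel (\<lambda>r. ennreal (2 * pi * r) * indicator {0..a} r)" (is "?N = ?M")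
proof (rule measure_eqI_lessThan)
  have N: "emeasure ?N {..x} = (if x < 0 then 0 else ennreal (pi * (min a x)\<^sup>2))" for x
  proof -
    have "emeasure ?N {..x} = emeasure lborel (cball (0 :: real \<times> real) a \<inter> {z. norm z \<le> x})"
    proof -
      have [measurable]: "cball (0 :: real \<times> real) a \<inter> {z. norm z \<le> x} \<in> sets borel"
        by (intro sets.Int borel_closed closed_Collect_le continuous_intros) auto
      have [measurable]: "norm -` {..x} \<in> sets (borel :: (real \<times> real) measure)"
        using measurable_sets[of norm "borel :: (real \<times> real) measure" borel "{..x}"] by simp
      have [measurable]: "cball (0 :: real \<times> real) a \<in> sets borel" by auto
      have "emeasure ?N {..x} = (\<integral>\<^sup>+z. indicator (cball 0 a) z * indicator (norm -` {..x}) z \<partial>(lborel :: (real \<times> real) measure))"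
        by (simp add: emeasure_distr emeasure_density)
      also have "\<dots> = (\<integral>\<^sup>+z. indicator (cball 0 a \<inter> {z. norm z \<le> x}) z \<partial>(lborel :: (real \<times> real) measure))"
        by (intro nn_integral_cong) (auto simp: indicator_def)
      finally show ?thesis by simp
    qed
    also have "cball (0 :: real \<times> real) a \<inter> {z. norm z \<le> x} = cball 0 (min a x)" by auto
    also have "emeasure lborel \<dots> = (if x < 0 then 0 else ennreal (pi * (min a x)\<^sup>2))"
      using a by (auto simp: emeasure_cball unit_ball_vol_2 power2_eq_square)
    finally show ?thesis .
  qed
  have M: "emeasure ?M {..x} = (if x < 0 then 0 else ennreal (pi * (min a x)\<^sup>2))" for x
  proof -
    have "emeasure ?M {..x} = (\<integral>\<^sup>+r. ennreal (2 * pi * r) * indicator {0..min a x} r \<partial>lborel)"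
      by (subst emeasure_density) (auto intro!: nn_integral_cong simp: indicator_def)
    also have "\<dots> = (if x < 0 then 0 else ennreal (pi * (min a x)\<^sup>2))"
    proof (cases "x < 0")
      case False
      have "(\<integral>\<^sup>+r. ennreal (2 * pi * r) * indicator {0..min a x} r \<partial>lborel)
          = ennreal (pi * (min a x)\<^sup>2 - pi * 0\<^sup>2)"
        using a False by (intro nn_integral_FTC_Icc) (auto intro!: derivative_eq_intros)
      then show ?thesis using False by simp
    qed (use a in auto)
    finally show ?thesis .
  qed
  have NU: "emeasure ?N UNIV = emeasure ?N {..a}"
  proof -
    have [measurable]: "cball (0 :: real \<times> real) a \<in> sets borel" by auto
    have "emeasure ?N UNIV = emeasure lborel (cball (0 :: real \<times> real) a)"
      by (simp add: emeasure_distr emeasure_density)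
    also have "\<dots> = emeasure ?N {..a}"
      unfolding N using a by (simp add: emeasure_cball unit_ball_vol_2 power2_eq_square)
    finally show ?thesis .
  qed
  have MU: "emeasure ?M UNIV = emeasure ?M {..a}"
    by (simp add: emeasure_density) (intro nn_integral_cong, auto simp: indicator_def)
  have eq: "{x<..} = space borel - {..x}" for x :: real by auto
  have N': "emeasure ?N {x<..} = emeasure ?N UNIV - emeasure ?N {..x}" for x
    using emeasure_compl[of "{..x}" ?N] N[of x] by (simp add: eq Compl_eq_Diff_UNIV split: if_splits)
  have M': "emeasure ?M {x<..} = emeasure ?M UNIV - emeasure ?M {..x}" for x
    using emeasure_compl[of "{..x}" ?M] M[of x] by (simp add: eq Compl_eq_Diff_UNIV split: if_splits)
  show "emeasure ?N {x<..} < \<infinity>" for x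
  proof -
    have "emeasure ?N {x<..} \<le> emeasure ?N UNIV" by (intro emeasure_mono) auto
    also have "\<dots> < \<infinity>" using NU N[of a] by simp
    finally show ?thesis .
  qed
  show "emeasure ?N {x<..} = emeasure ?M {x<..}" for x
    unfolding N' M' NU MU N M ..
qed auto

lemma disc_integral_radial:
  fixes h :: "real \<Rightarrow> complex"
  assumes a: "a > 0" and h: "continuous_on {0..a} h"
  shows "(LBINT x:cball (0 :: real \<times> real) a. h (norm x)) = (LBINT r:{0..a}. of_real (2 * pi * r) * h r)"
proof -
  let ?h = "\<lambda>r. indicator {0..a} r *\<^sub>R h r"
  have m [measurable]: "?h \<in> borel_measurable borel"
    using borel_integrable_compact[OF compact_Icc h] by (auto dest: borel_measurable_integrable)
  have [measurable]: "cball (0 :: real \<times> real) a \<in> sets borel" by auto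
  have i: "indicator (cball 0 a) = (\<lambda>x::real\<times>real. ennreal (indicator (cball 0 a) x))"
    by (auto simp: indicator_def)
  have j: "(\<lambda>r. ennreal (2 * pi * r) * indicator {0..a} r) = (\<lambda>r. ennreal (2 * pi * r * indicator {0..a} r))"
    by (auto simp: indicator_def)
  have "(LBINT x:cball (0 :: real \<times> real) a. h (norm x)) = (LBINT x. indicator (cball 0 a) x *\<^sub>R ?h (norm (x :: real \<times> real)))"
    unfolding set_lebesgue_integral_def by (intro Bochner_Integration.integral_cong) (auto simp: indicator_def)
  also have "\<dots> = (\<integral>x. ?h (norm (x :: real \<times> real)) \<partial>density lborel (indicator (cball 0 a)))"
    unfolding i by (subst integral_density) auto
  also have "\<dots> = (\<integral>r. ?h r \<partial>distr (density lborel (indicator (cball (0 :: real \<times> real) a))) borel norm)"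
    by (subst integral_distr) auto
  also have "\<dots> = (LBINT r. (2 * pi * r * indicator {0..a} r) *\<^sub>R ?h r)"
    unfolding distr_norm_disc[OF a] j
    by (rule integral_density) (use m in \<open>auto intro!: AE_I2 simp: indicator_def[of _ "_ :: real"]\<close>)
  also have "\<dots> = (LBINT r:{0..a}. of_real (2 * pi * r) * h r)"
    unfolding set_lebesgue_integral_def
    by (intro Bochner_Integration.integral_cong) (auto simp: indicator_def scaleR_conv_of_real)
  finally show ?thesis .
qed

lemma periodic_integral_shift:
  fixes f :: "real \<Rightarrow> complex"
  assumes f: "continuous_on UNIV f" and per: "\<And>t. f (t + 2 * pi) = f t" and \<phi>: "0 \<le> \<phi>" "\<phi> \<le> 2 * pi"
  shows "(LBINT t:{0..2 * pi}. f (t + \<phi>)) = (LBINT t:{0..2 * pi}. f t)"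
proof -
  have c: "continuous_on X f" for X using f continuous_on_subset by blast
  have cs: "continuous_on X (\<lambda>t. f (t + \<phi>))" for X
    by (rule continuous_on_compose2[OF f]) (auto intro!: continuous_intros)
  have io: "f integrable_on {u..v}" for u v by (intro integrable_continuous_interval c)
  have "(LBINT t:{0..2 * pi}. f (t + \<phi>)) = integral {0..2 * pi} (f \<circ> (\<lambda>t. t + \<phi>))"
    by (simp add: set_borel_integral_eq_integral(2) set_integrable_continuous_compact cs o_def)
  also have "\<dots> = integral {0 + \<phi>..2 * pi + \<phi>} f"
    using integral_shift_real_ivl[of "\<phi>" \<phi> "2 * pi + \<phi>" f] by (simp add: o_def)
  also have "\<dots> = integral {\<phi>..2 * pi} f + integral {2 * pi..2 * pi + \<phi>} f"
    using \<phi> by (subst Henstock_Kurzweil_Integration.integral_combine[where c = "2 * pi"]) (auto intro: io)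
  also have "integral {2 * pi..2 * pi + \<phi>} f = integral {0..\<phi>} f"
    using integral_shift_real_ivl[of "2 * pi" "2 * pi" "2 * pi + \<phi>" f] per by simp
  also have "integral {\<phi>..2 * pi} f + integral {0..\<phi>} f = integral {0..2 * pi} f"
    using \<phi> by (subst add.commute, subst Henstock_Kurzweil_Integration.integral_combine) (auto intro: io)
  finally show ?thesis
    by (simp add: set_borel_integral_eq_integral(2) set_integrable_continuous_compact c)
qed

lemma polar_decomposition: "x = (norm x * cos (polar_angle x), norm x * sin (polar_angle x))"
proof -
  have "Complex (fst x) (snd x) = of_real (cmod (Complex (fst x) (snd x))) * exp (\<i> * of_real (polar_angle x))"
    unfolding polar_angle_def by (rule Arg2pi_eq)
  moreover have "cmod (Complex (fst x) (snd x)) = norm x"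
    by (simp add: cmod_def norm_prod_def)
  ultimately have "Complex (fst x) (snd x) = of_real (norm x) * cis (polar_angle x)"
    by (simp add: cis_conv_exp)
  then show ?thesis by (auto simp: complex_eq_iff prod_eq_iff)
qed

text \<open>
  Averaging over all rotations does not change the integral of \<open>f\<close> but replaces \<open>f\<close> by a
  radial function, namely its angular integral; the integral of a radial function is
  governed by the distribution of the norm.
\<close>

lemma disc_integral_polar:
  fixes f :: "real \<times> real \<Rightarrow> complex"
  assumes a: "a > 0" and f: "continuous_on (cball 0 a) f"
  shows "(LBINT x:cball 0 a. f x)
       = (LBINT r:{0..a}. LBINT \<theta>:{0..2 * pi}. f (r * cos \<theta>, r * sin \<theta>) * of_real r)"
proof -
  define H where "H r = (LBINT \<theta>:{0..2 * pi}. f (rot \<theta> (r, 0)))" for r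
  have H: "H r = (LBINT \<theta>:{0..2 * pi}. f (r * cos \<theta>, r * sin \<theta>))" for r
    by (simp add: H_def rot_def mult.commute)
  have Hc: "continuous_on {0..a} H"
    unfolding H_def
  proof (rule continuous_on_parametric_integral)
    have "continuous_on ({0..a} \<times> {0..2 * pi}) (\<lambda>z. f (rot (snd z) (fst z, 0)))"
      by (rule continuous_on_compose2[OF f]) (auto intro!: continuous_intros simp: norm_rot)
    then show "continuous_on ({0..a} \<times> {0..2 * pi}) (\<lambda>(r, \<theta>). f (rot \<theta> (r, 0)))"
      by (simp add: case_prod_unfold)
  qed
  have inner: "(LBINT t:{0..2 * pi}. f (rot t x)) = H (norm x)" if x: "x \<in> cball 0 a" for x
  proof -
    have "x = rot (polar_angle x) (norm x, 0)"
      using polar_decomposition[of x] by (simp add: rot_def mult.commute)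
    then have eq: "rot t x = rot (t + polar_angle x) (norm x, 0)" for t by (metis rot_rot)
    have "continuous_on UNIV (\<lambda>t. f (rot t (norm x, 0)))"
      by (rule continuous_on_compose2[OF f]) (use x in \<open>auto intro!: continuous_intros simp: norm_rot\<close>)
    then show ?thesis unfolding eq H_def
      by (rule periodic_integral_shift) 
        (auto simp: rot_def polar_angle_def Arg2pi_ge_0 Arg2pi_lt_2pi less_imp_le)
  qed
  \<comment> \<open>By rotation invariance the integrand on the right does not depend on \<open>t\<close>.\<close>
  have "2 * pi * (LBINT x:cball 0 a. f x) = (LBINT t:{0..2 * pi}. LBINT x:cball 0 a. f (rot t x))"
    unfolding disc_integral_rot[OF f]
    by (simp add: set_lebesgue_integral_def[of _ "{0..2 * pi}"] scaleR_conv_of_real)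
  also have "\<dots> = (LBINT x:cball 0 a. LBINT t:{0..2 * pi}. f (rot t x))"
  proof (rule Fubini_compact)
    have "continuous_on ({0..2 * pi} \<times> cball 0 a) (\<lambda>z. f (rot (fst z) (snd z)))"
      by (rule continuous_on_compose2[OF f]) (auto intro!: continuous_intros simp: norm_rot)
    then show "continuous_on ({0..2 * pi} \<times> cball 0 a) (\<lambda>(t, x). f (rot t x))"
      by (simp add: case_prod_unfold)
  qed auto
  also have "\<dots> = (LBINT x:cball 0 a. H (norm (x :: real \<times> real)))"
    unfolding set_lebesgue_integral_def
    by (intro Bochner_Integration.integral_cong) (use inner in \<open>auto simp: indicator_def set_lebesgue_integral_def\<close>)
  also have "\<dots> = (LBINT r:{0..a}. of_real (2 * pi * r) * H r)"
    by (rule disc_integral_radial[OF a Hc])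
  also have "\<dots> = 2 * pi * (LBINT r:{0..a}. H r * of_real r)"
    by (simp add: mult.assoc mult.left_commute flip: set_integral_mult_right) (simp add: mult_ac)
  finally have "(LBINT x:cball 0 a. f x) = (LBINT r:{0..a}. H r * of_real r)"
    by simp
  then show ?thesis by (simp add: H)
qed

section \<open>Radial moments of the Zernike polynomials\<close>

text \<open>
  Summation by parts via Pascal's rule: the alternating binomial sum is an iterated
  difference.
\<close>

lemma alternating_binomial_sum_Suc:
  fixes f :: "nat \<Rightarrow> real"
  shows "(\<Sum>i\<le>Suc s. (-1) ^ i * real (Suc s choose i) * f i)
       = (\<Sum>i\<le>s. (-1) ^ i * real (s choose i) * (f i - f (Suc i)))"
proof -
  have "(\<Sum>i\<le>Suc s. (-1) ^ i * real (Suc s choose i) * f i)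
      = f 0 + (\<Sum>i\<le>s. (-1) ^ Suc i * real (s choose i) * f (Suc i))
            + (\<Sum>i\<le>s. (-1) ^ Suc i * real (s choose Suc i) * f (Suc i))"
    by (subst sum.atMost_Suc_shift) (simp add: algebra_simps sum.distrib sum_negf sum_subtractf)
  also have "f 0 + (\<Sum>i\<le>s. (-1) ^ Suc i * real (s choose i) * f (Suc i))
            + (\<Sum>i\<le>s. (-1) ^ Suc i * real (s choose Suc i) * f (Suc i))
      = (\<Sum>i\<le>Suc s. (-1) ^ i * real (s choose i) * f i)
        + (\<Sum>i\<le>s. (-1) ^ Suc i * real (s choose i) * f (Suc i))"
    by (subst sum.atMost_Suc_shift) simp
  also have "(\<Sum>i\<le>Suc s. (-1) ^ i * real (s choose i) * f i) = (\<Sum>i\<le>s. (-1) ^ i * real (s choose i) * f i)"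
    by simp
  finally show ?thesis by (simp add: algebra_simps sum_subtractf sum_negf sum.distrib)
qed

text \<open>
  The \<open>s\<close>-th difference of a polynomial of degree \<open>t < s\<close> vanishes.
\<close>

lemma alternating_pochhammer_sum_eq_0:
  fixes c :: real
  shows "t < s \<Longrightarrow> (\<Sum>i\<le>s. (-1) ^ i * real (s choose i) * pochhammer (c + real i) t) = 0"
proof (induction s arbitrary: c t)
  case (Suc s)
  show ?case
  proof (cases t)
    case 0
    then show ?thesis by (subst alternating_binomial_sum_Suc) simp
  next
    case (Suc u)
    have "pochhammer (c + real i) t - pochhammer (c + real (Suc i)) t
        = - real (Suc u) * pochhammer (c + 1 + real i) u" for i
    proof -
      have "pochhammer (c + real i) t = (c + real i) * pochhammer (c + 1 + real i) u"
        unfolding Suc pochhammer_rec by (simp add: add_ac)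
      moreover have "pochhammer (c + real (Suc i)) t = pochhammer (c + 1 + real i) u * (c + 1 + real i + real u)"
        unfolding Suc pochhammer_Suc by (simp add: add_ac)
      ultimately show ?thesis by (simp add: algebra_simps)
    qed
    then have "(\<Sum>i\<le>Suc s. (-1) ^ i * real (Suc s choose i) * pochhammer (c + real i) t)
        = - real (Suc u) * (\<Sum>i\<le>s. (-1) ^ i * real (s choose i) * pochhammer (c + 1 + real i) u)"
      by (subst alternating_binomial_sum_Suc) (simp add: sum_distrib_left mult_ac)
    then show ?thesis using Suc.IH[of u "c + 1"] Suc.prems Suc by simp
  qed
qed simp

lemma alternating_partial_fractions:
  fixes X :: real
  shows "X > 0 \<Longrightarrow> (\<Sum>i\<le>s. (-1) ^ i * real (s choose i) * (1 / (X + real i))) = fact s / pochhammer X (Suc s)"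
proof (induction s arbitrary: X)
  case (Suc s)
  let ?P = "pochhammer (X + 1) (Suc s)"
  have P: "?P > 0" and Q: "pochhammer X (Suc s) > 0" using Suc.prems by (auto intro!: pochhammer_pos)
  have e: "pochhammer X (Suc (Suc s)) = X * ?P" "pochhammer X (Suc (Suc s)) = pochhammer X (Suc s) * (X + real (Suc s))"
    by (rule pochhammer_rec, rule pochhammer_Suc)
  have "(\<Sum>i\<le>Suc s. (-1) ^ i * real (Suc s choose i) * (1 / (X + real i)))
     = (\<Sum>i\<le>s. (-1) ^ i * real (s choose i) * (1 / (X + real i)))
       - (\<Sum>i\<le>s. (-1) ^ i * real (s choose i) * (1 / (X + 1 + real i)))"
    by (subst alternating_binomial_sum_Suc) (simp add: algebra_simps sum_subtractf)
  also have "\<dots> = fact s / pochhammer X (Suc s) - fact s / ?P"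
    using Suc.IH[of X] Suc.IH[of "X + 1"] Suc.prems by simp
  also have "fact s / pochhammer X (Suc s) = fact s * (X + real (Suc s)) / pochhammer X (Suc (Suc s))"
  proof -
    have "X + real (Suc s) \<noteq> 0" using Suc.prems by linarith
    then show ?thesis unfolding e(2) by (simp del: of_nat_Suc)
  qed
  also have "fact s / ?P = fact s * X / pochhammer X (Suc (Suc s))"
    unfolding e(1) using Suc.prems by simp
  finally show ?case by (simp add: diff_divide_distrib[symmetric] algebra_simps)
qed simp

text \<open>
  Partial fractions with a polynomial numerator of degree at most \<open>s\<close>. Writing the new
  factor \<open>c + i + t\<close> as \<open>(X + i) + (c - X + t)\<close> splits off a sum that vanishes by the
  degree bound, so each step just multiplies by the value of the factor at the pole.
\<close>

lemma alternating_partial_fractions_pochhammer: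
  fixes X c :: real
  assumes X: "X > 0"
  shows "t \<le> s \<Longrightarrow> (\<Sum>i\<le>s. (-1) ^ i * real (s choose i) * (pochhammer (c + real i) t / (X + real i)))
     = fact s * pochhammer (c - X) t / pochhammer X (Suc s)"
proof (induction t)
  case 0
  then show ?case using alternating_partial_fractions[OF X, of s] by simp
next
  case (Suc t)
  have "pochhammer (c + real i) (Suc t) / (X + real i)
      = pochhammer (c + real i) t + (c - X + real t) * (pochhammer (c + real i) t / (X + real i))" for i
  proof -
    have "X + real i \<noteq> 0" using X by linarith
    then show ?thesis by (simp add: pochhammer_Suc field_simps)
  qed
  then have "(\<Sum>i\<le>s. (-1) ^ i * real (s choose i) * (pochhammer (c + real i) (Suc t) / (X + real i)))
     = (\<Sum>i\<le>s. (-1) ^ i * real (s choose i) * pochhammer (c + real i) t)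
       + (c - X + real t) * (\<Sum>i\<le>s. (-1) ^ i * real (s choose i) * (pochhammer (c + real i) t / (X + real i)))"
    by (simp only: distrib_left sum.distrib sum_distrib_left) (simp add: mult_ac)
  also have "\<dots> = fact s * pochhammer (c - X) (Suc t) / pochhammer X (Suc s)"
    using Suc alternating_pochhammer_sum_eq_0[of t s c] by (simp add: pochhammer_Suc[of "c - X"] del: pochhammer_Suc)
  finally show ?case .
qed

lemma pochhammer_nat_plus_1: "pochhammer (real k + 1) n = fact (k + n) / fact k"
  using pochhammer_product[of k "k + n" "1 :: real"] by (simp add: pochhammer_fact[symmetric] add.commute)

text \<open>
  The coefficient of \<open>r ^ (\<mu> + 2 * (s - j))\<close> in the radial polynomial with \<open>\<bar>m\<bar> = \<mu>\<close> and
  \<open>n = \<mu> + 2 * s\<close>.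
\<close>

definition zernike_monomial_coeff :: "nat \<Rightarrow> nat \<Rightarrow> nat \<Rightarrow> real" where
  "zernike_monomial_coeff \<mu> s j = (-1) ^ j * fact (\<mu> + 2 * s - j) / (fact j * fact (\<mu> + s - j) * fact (s - j))"

text \<open>
  The left side is the integral over \<open>[0, 1]\<close> of \<open>r\<close> times the radial polynomial times
  \<open>r ^ (\<mu> + 2 * l)\<close>. Reversing the sum turns the factorials into the polynomial
  \<open>(\<mu> + 1 + i) \<cdots> (\<mu> + s + i)\<close> over \<open>X + i\<close> with \<open>X = \<mu> + l + 1\<close>; its value at the pole
  \<open>i = - X\<close> is \<open>(- l) (1 - l) \<cdots> (s - 1 - l)\<close>, which vanishes precisely for \<open>l < s\<close>.
\<close>

lemma zernike_moment_sum:
  "(\<Sum>j\<le>s. zernike_monomial_coeff \<mu> s j / real (2 * (\<mu> + (s - j) + l) + 2))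
   = (if l < s then 0 else fact l * fact (l + \<mu>) / (2 * fact (l - s) * fact (l + \<mu> + s + 1)))"
proof -
  define X where "X = real (\<mu> + l + 1)"
  have X: "X > 0" by (simp add: X_def)
  have "(\<Sum>j\<le>s. zernike_monomial_coeff \<mu> s j / real (2 * (\<mu> + (s - j) + l) + 2))
      = (\<Sum>i\<le>s. (-1) ^ s / (2 * fact s) *
          ((-1) ^ i * real (s choose i) * (pochhammer (real \<mu> + 1 + real i) s / (X + real i))))"
  proof (rule sum.reindex_bij_witness[of _ "\<lambda>i. s - i" "\<lambda>i. s - i"])
    fix j assume "j \<in> {..s}"
    then obtain i where i: "s = j + i" using le_Suc_ex by auto
    have p: "pochhammer (real \<mu> + 1 + real i) s = fact (\<mu> + i + s) / fact (\<mu> + i)"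
      using pochhammer_nat_plus_1[of "\<mu> + i" s] by (simp add: add_ac)
    have c: "real (s choose i) = fact s / (fact i * fact j)"
      using binomial_fact[of i s, where 'a = real] by (simp add: i)
    have d: "real (2 * (\<mu> + i + l) + 2) = 2 * (X + real i)" by (simp add: X_def)
    have n: "\<mu> + 2 * s - j = \<mu> + i + s" "\<mu> + s - j = \<mu> + i" "s - j = i" using i by auto
    have "(-1) ^ i * (-1) ^ i = (1 :: real)" by (simp flip: power_mult_distrib)
    then have "(-1) ^ s * (-1) ^ i = (-1 :: real) ^ j" by (simp add: i power_add mult.assoc)
    then show "(-1) ^ s / (2 * fact s) * ((-1) ^ (s - j) * real (s choose (s - j)) *
          (pochhammer (real \<mu> + 1 + real (s - j)) s / (X + real (s - j))))
        = zernike_monomial_coeff \<mu> s j / real (2 * (\<mu> + (s - j) + l) + 2)"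
      using X unfolding zernike_monomial_coeff_def n p c d by (simp add: field_simps)
  qed auto
  also have "\<dots> = (-1) ^ s / (2 * fact s) * (fact s * pochhammer (real \<mu> + 1 - X) s / pochhammer X (Suc s))"
    by (simp only: sum_distrib_left[symmetric] alternating_partial_fractions_pochhammer[OF X order_refl])
  also have "real \<mu> + 1 - X = - real l" by (simp add: X_def)
  also have "pochhammer X (Suc s) = fact (l + \<mu> + s + 1) / fact (l + \<mu>)"
    using pochhammer_nat_plus_1[of "\<mu> + l" "Suc s"] by (simp add: X_def add_ac del: pochhammer_Suc)
  also have "pochhammer (- real l) s = (if l < s then 0 else (-1) ^ s * (fact l / fact (l - s)))"
  proof (cases "l < s")
    case False
    then have "pochhammer (- real l) s = (-1) ^ s * pochhammer (real (l - s) + 1) s"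
      by (simp add: pochhammer_minus of_nat_diff)
    also have "pochhammer (real (l - s) + 1) s = fact l / fact (l - s)"
      using False by (subst pochhammer_nat_plus_1) simp
    finally show ?thesis using False by simp
  qed (simp add: pochhammer_of_nat_eq_0_lemma)
  finally show ?thesis by (simp add: field_simps power_mult_distrib[symmetric])
qed

section \<open>The Zernike system\<close>

definition planar_monomial :: "nat \<Rightarrow> nat \<Rightarrow> real \<times> real \<Rightarrow> complex" where
  "planar_monomial p q x = Complex (fst x) (snd x) ^ p * cnj (Complex (fst x) (snd x)) ^ q"

text \<open>
  In polar coordinates this is \<open>r ^ (\<bar>m\<bar> + 2 * l)\<close> times \<open>exp (\<i> m \<theta>)\<close>. The truncation in
  \<open>nat m\<close> and \<open>nat (- m)\<close> treats both signs of \<open>m\<close> at once.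
\<close>

definition angular_monomial :: "int \<Rightarrow> nat \<Rightarrow> real \<times> real \<Rightarrow> complex" where
  "angular_monomial m l = planar_monomial (nat m + l) (nat (- m) + l)"

lemma continuous_on_planar_monomial [continuous_intros]: "continuous_on U (planar_monomial p q)"
proof -
  have "planar_monomial p q = (\<lambda>x. (of_real (fst x) + \<i> * of_real (snd x)) ^ p * cnj (of_real (fst x) + \<i> * of_real (snd x)) ^ q)"
    by (simp add: planar_monomial_def Complex_eq fun_eq_iff)
  then show ?thesis by (auto intro!: continuous_intros)
qed

lemma continuous_on_angular_monomial [continuous_intros]: "continuous_on U (angular_monomial m l)"
  unfolding angular_monomial_def by (rule continuous_on_planar_monomial)

lemma planar_monomial_polar:
  "planar_monomial p q (r * cos \<theta>, r * sin \<theta>)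
     = of_real r ^ (p + q) * exp (\<i> * of_int (int p - int q) * of_real \<theta>)"
proof -
  have z: "Complex (r * cos \<theta>) (r * sin \<theta>) = of_real r * exp (\<i> * of_real \<theta>)"
    by (simp add: complex_eq_iff Re_exp Im_exp)
  have "exp (\<i> * of_real \<theta>) ^ p * cnj (exp (\<i> * of_real \<theta>)) ^ q
      = exp (of_nat p * (\<i> * of_real \<theta>)) * exp (of_nat q * (- (\<i> * of_real \<theta>)))"
    unfolding exp_of_nat_mult by (simp add: exp_cnj)
  also have "\<dots> = exp (\<i> * of_int (int p - int q) * of_real \<theta>)"
    by (subst exp_add[symmetric]) (simp add: algebra_simps)
  finally show ?thesis
    unfolding planar_monomial_def by (simp add: z power_mult_distrib power_add mult_ac)
qed

lemma angular_monomial_polar: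
  "angular_monomial m l (r * cos \<theta>, r * sin \<theta>)
     = of_real r ^ (nat \<bar>m\<bar> + 2 * l) * exp (\<i> * of_int m * of_real \<theta>)"
proof -
  have "nat m + l + (nat (- m) + l) = nat \<bar>m\<bar> + 2 * l" "int (nat m + l) - int (nat (- m) + l) = m"
    by (auto simp: abs_if)
  then show ?thesis unfolding angular_monomial_def planar_monomial_polar by (simp only:)
qed

lemma zernike_indices_iff: "n \<in> zernike_indices m \<longleftrightarrow> (\<exists>s. n = nat \<bar>m\<bar> + 2 * s)"
proof
  assume "n \<in> zernike_indices m"
  then have n: "nat \<bar>m\<bar> \<le> n" "even (int n - \<bar>m\<bar>)" by (auto simp: zernike_indices_def)
  then have "even (n - nat \<bar>m\<bar>)"
    by (metis even_of_nat int_nat_eq abs_ge_zero of_nat_diff)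
  then obtain s where "n - nat \<bar>m\<bar> = 2 * s" by (elim evenE)
  then show "\<exists>s. n = nat \<bar>m\<bar> + 2 * s" using n by (intro exI[of _ s]) auto
qed (auto simp: zernike_indices_def)

lemma zernike_radial_eq:
  "zernike_radial (nat \<bar>m\<bar> + 2 * s) m r
     = (\<Sum>j\<le>s. zernike_monomial_coeff (nat \<bar>m\<bar>) s j * r ^ (nat \<bar>m\<bar> + 2 * (s - j)))"
  unfolding zernike_radial_def Let_def zernike_monomial_coeff_def atLeast0AtMost
  by (intro sum.cong) (auto simp: diff_mult_distrib2)

definition zernike_norm :: "real \<Rightarrow> nat \<Rightarrow> real" where
  "zernike_norm a n = 1 / a * sqrt ((real n + 1) / pi)"

definition zernike_fun :: "real \<Rightarrow> int \<times> nat \<Rightarrow> real \<times> real \<Rightarrow> complex" where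
  "zernike_fun a i = (\<lambda>x. zernike a (snd i) (fst i) (norm x) (polar_angle x))"

lemma zernike_eq:
  "zernike a (nat \<bar>m\<bar> + 2 * s) m r \<theta> =
     (\<Sum>j\<le>s. of_real (zernike_norm a (nat \<bar>m\<bar> + 2 * s) * zernike_monomial_coeff (nat \<bar>m\<bar>) s j / a ^ (nat \<bar>m\<bar> + 2 * (s - j)))
        * angular_monomial m (s - j) (r * cos \<theta>, r * sin \<theta>))"
  unfolding zernike_def zernike_radial_eq angular_monomial_polar zernike_norm_def
  by (simp add: sum_distrib_left sum_distrib_right power_divide mult_ac)

text \<open>
  In this form the function is visibly a polynomial, hence continuous, although the polar
  angle is not.
\<close>

lemma zernike_fun_eq:
  "zernike_fun a (m, nat \<bar>m\<bar> + 2 * s) =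
     (\<lambda>x. \<Sum>j\<le>s. of_real (zernike_norm a (nat \<bar>m\<bar> + 2 * s) * zernike_monomial_coeff (nat \<bar>m\<bar>) s j / a ^ (nat \<bar>m\<bar> + 2 * (s - j)))
        * angular_monomial m (s - j) x)"
  unfolding zernike_fun_def fst_conv snd_conv zernike_eq polar_decomposition[symmetric] ..

lemma zernike_fun_polar:
  assumes "n \<in> zernike_indices m"
  shows "zernike_fun a (m, n) (r * cos \<theta>, r * sin \<theta>) = zernike a n m r \<theta>"
  using assms by (auto simp: zernike_indices_iff zernike_fun_eq zernike_eq)

lemma continuous_on_zernike_fun:
  assumes "n \<in> zernike_indices m"
  shows "continuous_on U (zernike_fun a (m, n))"
proof -
  obtain s where s: "n = nat \<bar>m\<bar> + 2 * s" using assms by (auto simp: zernike_indices_iff)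
  show ?thesis unfolding s zernike_fun_eq by (intro continuous_intros)
qed

lemma zernike_coeff_eq_inner_on:
  assumes a: "a > 0" and n: "n \<in> zernike_indices m" and f: "continuous_on (cball 0 a) f"
  shows "zernike_coeff a n m f = inner_on (cball 0 a) f (zernike_fun a (m, n))"
  unfolding inner_on_def zernike_coeff_def
  by (subst disc_integral_polar[OF a])
     (auto intro!: continuous_intros f continuous_on_zernike_fun n simp: zernike_fun_polar[OF n] polar_def)

lemma angular_integral:
  "(LBINT \<theta>:{0..2 * pi}. exp (\<i> * of_int k * of_real \<theta>)) = (if k = 0 then 2 * of_real pi else 0)"
proof (cases "k = 0")
  case True
  then show ?thesis by (simp add: set_lebesgue_integral_def scaleR_conv_of_real)
next
  case False
  let ?F = "\<lambda>\<theta>. exp (\<i> * of_int k * of_real \<theta>) / (\<i> * of_int k)"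
  have "((\<lambda>\<theta>. exp (\<i> * of_int k * of_real \<theta>)) has_integral ?F (2 * pi) - ?F 0) {0..2 * pi}"
    using False
    by (intro fundamental_theorem_of_calculus)
       (auto intro!: derivative_eq_intros has_vector_derivative_real_field)
  moreover have "exp (\<i> * of_int k * of_real (2 * pi)) = (1 :: complex)"
    using exp_integer_2pi[of "of_int k"] by (simp add: mult_ac)
  ultimately have "((\<lambda>\<theta>. exp (\<i> * of_int k * of_real \<theta>)) has_integral 0) {0..2 * pi}" by simp
  then show ?thesis using False
    by (subst set_borel_integral_eq_integral(2))
       (auto intro!: set_integrable_continuous_compact continuous_intros integral_unique)
qed

lemma radial_power_integral:
  assumes "a > 0"
  shows "(LBINT r:{0..a}. complex_of_real (r ^ k)) = of_real (a ^ Suc k / real (Suc k))"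
  using integral_power[of 0 a k] assms
  by (simp only: set_integral_complex_of_real set_lebesgue_integral_def) (simp add: mult.commute)

lemma inner_on_angular_monomial:
  assumes a: "a > 0"
  shows "inner_on (cball 0 a) (angular_monomial m l) (angular_monomial m' l')
    = (if m = m' then of_real (2 * pi * a ^ (2 * (nat \<bar>m\<bar> + l' + l) + 2) / real (2 * (nat \<bar>m\<bar> + l' + l) + 2)) else 0)"
proof -
  define N where "N = (nat \<bar>m\<bar> + 2 * l) + (nat \<bar>m'\<bar> + 2 * l') + 1"
  have "inner_on (cball 0 a) (angular_monomial m l) (angular_monomial m' l')
     = (LBINT r:{0..a}. LBINT \<theta>:{0..2 * pi}. of_real (r ^ N) * exp (\<i> * of_int (m - m') * of_real \<theta>))"
    unfolding inner_on_def
  proof (subst disc_integral_polar[OF a])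
    have "angular_monomial m l (r * cos \<theta>, r * sin \<theta>) * cnj (angular_monomial m' l' (r * cos \<theta>, r * sin \<theta>)) * of_real r
        = of_real (r ^ N) * exp (\<i> * of_int (m - m') * of_real \<theta>)" for r \<theta>
    proof -
      have "exp (\<i> * of_int m * of_real \<theta>) * cnj (exp (\<i> * of_int m' * of_real \<theta>)) = exp (\<i> * of_int (m - m') * of_real \<theta>)"
        unfolding exp_cnj by (subst exp_add[symmetric]) (simp add: algebra_simps)
      then show ?thesis unfolding angular_monomial_polar N_def
        by (simp add: power_add mult_ac)
    qed
    then show "(LBINT r:{0..a}. LBINT \<theta>:{0..2 * pi}. angular_monomial m l (r * cos \<theta>, r * sin \<theta>) * cnj (angular_monomial m' l' (r * cos \<theta>, r * sin \<theta>)) * of_real r)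
      = (LBINT r:{0..a}. LBINT \<theta>:{0..2 * pi}. of_real (r ^ N) * exp (\<i> * of_int (m - m') * of_real \<theta>))"
      by simp
  qed (auto intro!: continuous_intros)
  also have "\<dots> = of_real (a ^ Suc N / real (Suc N)) * (if m = m' then 2 * of_real pi else 0)"
    by (simp only: set_integral_mult_right set_integral_mult_left angular_integral radial_power_integral[OF a]) auto
  also have "\<dots> = (if m = m' then of_real (2 * pi * a ^ (2 * (nat \<bar>m\<bar> + l' + l) + 2) / real (2 * (nat \<bar>m\<bar> + l' + l) + 2)) else 0)"
  proof (cases "m = m'")
    case True
    have "Suc N = 2 * (nat \<bar>m\<bar> + l' + l) + 2" by (simp add: N_def True)
    then show ?thesis using True by (simp only: if_True of_real_mult of_real_divide of_real_numeral) simp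
  qed simp
  finally show ?thesis .
qed

lemma inner_on_sum_scaled_right:
  assumes "compact S" "continuous_on S f" "\<And>j. j \<in> A \<Longrightarrow> continuous_on S (g j)"
  shows "inner_on S f (\<lambda>x. \<Sum>j\<in>A. of_real (c j) * g j x) = (\<Sum>j\<in>A. of_real (c j) * inner_on S f (g j))"
proof -
  have "inner_on S (\<lambda>x. \<Sum>j\<in>A. of_real (c j) * g j x) f = (\<Sum>j\<in>A. of_real (c j) * inner_on S (g j) f)"
    using assms by (subst inner_on_sum_left) (auto intro!: continuous_intros simp: inner_on_scale_left)
  then show ?thesis
    by (subst inner_on_commute) (simp add: inner_on_commute[of S f])
qed

lemma zernike_moment:
  assumes a: "a > 0"
  shows "inner_on (cball 0 a) (angular_monomial m l) (zernike_fun a (m', nat \<bar>m'\<bar> + 2 * s))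
    = (if m = m' \<and> s \<le> l
       then of_real (2 * pi * zernike_norm a (nat \<bar>m\<bar> + 2 * s) * a ^ (nat \<bar>m\<bar> + 2 * l + 2)
              * (fact l * fact (l + nat \<bar>m\<bar>) / (2 * fact (l - s) * fact (l + nat \<bar>m\<bar> + s + 1))))
       else 0)"
proof -
  let ?\<mu> = "nat \<bar>m'\<bar>" let ?c = "zernike_norm a (?\<mu> + 2 * s)"
  have "inner_on (cball 0 a) (angular_monomial m l) (zernike_fun a (m', ?\<mu> + 2 * s))
     = (\<Sum>j\<le>s. of_real (?c * zernike_monomial_coeff ?\<mu> s j / a ^ (?\<mu> + 2 * (s - j)))
         * inner_on (cball 0 a) (angular_monomial m l) (angular_monomial m' (s - j)))"
    unfolding zernike_fun_eq by (rule inner_on_sum_scaled_right) (auto intro!: continuous_intros)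
  also have "\<dots> = (if m = m' then of_real (\<Sum>j\<le>s. 2 * pi * ?c * a ^ (?\<mu> + 2 * l + 2) *
       (zernike_monomial_coeff ?\<mu> s j / real (2 * (?\<mu> + (s - j) + l) + 2))) else 0)"
  proof (cases "m = m'")
    case True
    have "of_real (?c * zernike_monomial_coeff ?\<mu> s j / a ^ (?\<mu> + 2 * (s - j)))
         * inner_on (cball 0 a) (angular_monomial m l) (angular_monomial m' (s - j))
      = complex_of_real (2 * pi * ?c * a ^ (?\<mu> + 2 * l + 2) *
       (zernike_monomial_coeff ?\<mu> s j / real (2 * (?\<mu> + (s - j) + l) + 2)))" for j
    proof -
      have aux: "c * z / A * (2 * pi * B / N) = 2 * pi * c * (B / A) * (z / N)" for c z A B N :: real
        by simp
      have e: "2 * (?\<mu> + (s - j) + l) + 2 = (?\<mu> + 2 * l + 2) + (?\<mu> + 2 * (s - j))" by simp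
      have "a ^ (2 * (?\<mu> + (s - j) + l) + 2) / a ^ (?\<mu> + 2 * (s - j)) = a ^ (?\<mu> + 2 * l + 2)"
        unfolding e using a by (subst power_add) simp
      then have "?c * zernike_monomial_coeff ?\<mu> s j / a ^ (?\<mu> + 2 * (s - j)) *
          (2 * pi * a ^ (2 * (?\<mu> + (s - j) + l) + 2) / real (2 * (?\<mu> + (s - j) + l) + 2))
        = 2 * pi * ?c * a ^ (?\<mu> + 2 * l + 2) * (zernike_monomial_coeff ?\<mu> s j / real (2 * (?\<mu> + (s - j) + l) + 2))"
        using aux by (metis (no_types, lifting))
      then show ?thesis unfolding inner_on_angular_monomial[OF a] by (simp only: True refl if_True simp_thms flip: of_real_mult)
    qed
    then show ?thesis using True by (simp only: of_real_sum simp_thms if_True)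
  qed (simp add: inner_on_angular_monomial[OF a])
  also have "\<dots> = (if m = m' then of_real (2 * pi * ?c * a ^ (?\<mu> + 2 * l + 2) *
       (if l < s then 0 else fact l * fact (l + ?\<mu>) / (2 * fact (l - s) * fact (l + ?\<mu> + s + 1)))) else 0)"
    by (simp only: sum_distrib_left[symmetric] zernike_moment_sum)
  finally show ?thesis by auto
qed

lemma zernike_norm_square:
  assumes "a > 0"
  shows "(zernike_norm a n)\<^sup>2 * pi * a\<^sup>2 = real n + 1"
  using assms by (simp add: zernike_norm_def power_mult_distrib power_divide)

text \<open>
  Take the function with the smaller radial index \<open>s\<close> and expand it into monomials. All of
  them have vanishing moment against the other one, except the leading monomial when both
  indices agree.
\<close>

lemma zernike_orthonormal:
  assumes a: "a > 0"
  shows "orthonormal_on (cball 0 a) (zernike_fun a) (SIGMA m:UNIV. zernike_indices m)"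
proof -
  have le: "inner_on (cball 0 a) (zernike_fun a (m, nat \<bar>m\<bar> + 2 * s)) (zernike_fun a (m', nat \<bar>m'\<bar> + 2 * s'))
     = (if m = m' \<and> s = s' then 1 else 0)" if "s \<le> s'" for m m' s s'
  proof -
    let ?\<mu> = "nat \<bar>m\<bar>" let ?c = "zernike_norm a (?\<mu> + 2 * s)" let ?V = "zernike_fun a (m', nat \<bar>m'\<bar> + 2 * s')"
    have "inner_on (cball 0 a) (zernike_fun a (m, ?\<mu> + 2 * s)) ?V
       = (\<Sum>j\<le>s. of_real (?c * zernike_monomial_coeff ?\<mu> s j / a ^ (?\<mu> + 2 * (s - j)))
           * inner_on (cball 0 a) (angular_monomial m (s - j)) ?V)"
      unfolding zernike_fun_eq[of a m]
    proof (subst inner_on_sum_left)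
      show "continuous_on (cball 0 a) ?V"
        by (rule continuous_on_zernike_fun) (auto simp: zernike_indices_iff)
    qed (simp_all only: compact_cball inner_on_scale_left, intro continuous_intros)
    also have "\<dots> = (\<Sum>j\<le>s. if j = 0 then of_real (?c * zernike_monomial_coeff ?\<mu> s 0 / a ^ (?\<mu> + 2 * s))
           * inner_on (cball 0 a) (angular_monomial m s) ?V else 0)"
      using that by (intro sum.cong) (auto simp: zernike_moment[OF a])
    also have "\<dots> = of_real (?c * zernike_monomial_coeff ?\<mu> s 0 / a ^ (?\<mu> + 2 * s))
           * inner_on (cball 0 a) (angular_monomial m s) ?V"
      by simp
    also have "\<dots> = (if m = m' \<and> s = s' then 1 else 0)"
    proof (cases "m = m' \<and> s = s'")
      case True
      have 1: "?c * zernike_monomial_coeff ?\<mu> s 0 / a ^ (?\<mu> + 2 * s) *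
         (2 * pi * ?c * a ^ (?\<mu> + 2 * s + 2) * (fact s * fact (s + ?\<mu>) / (2 * fact (s - s) * fact (s + ?\<mu> + s + 1))))
        = (?c\<^sup>2 * pi * a\<^sup>2) * (zernike_monomial_coeff ?\<mu> s 0 * fact s * fact (s + ?\<mu>) / fact (s + ?\<mu> + s + 1))"
        using a by (simp add: power_add power2_eq_square)
      have 2: "zernike_monomial_coeff ?\<mu> s 0 * fact s * fact (s + ?\<mu>) = fact (?\<mu> + 2 * s)"
        by (simp add: zernike_monomial_coeff_def add.commute)
      have 3: "fact (s + ?\<mu> + s + 1) = (real (?\<mu> + 2 * s) + 1) * (fact (?\<mu> + 2 * s) :: real)"
      proof -
        have "s + ?\<mu> + s + 1 = Suc (?\<mu> + 2 * s)" by simp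
        then show ?thesis by (simp only: fact_Suc of_nat_Suc add.commute)
      qed
      have 4: "?c\<^sup>2 * pi * a\<^sup>2 = real (?\<mu> + 2 * s) + 1"
        by (rule zernike_norm_square[OF a])
      have 5: "(real (?\<mu> + 2 * s) + 1) * (fact (?\<mu> + 2 * s) / ((real (?\<mu> + 2 * s) + 1) * fact (?\<mu> + 2 * s))) = (1 :: real)"
      proof -
        have "real (?\<mu> + 2 * s) + 1 > 0" by linarith
        then show ?thesis by (simp del: of_nat_add)
      qed
      have "?c * zernike_monomial_coeff ?\<mu> s 0 / a ^ (?\<mu> + 2 * s) *
         (2 * pi * ?c * a ^ (?\<mu> + 2 * s + 2) * (fact s * fact (s + ?\<mu>) / (2 * fact (s - s) * fact (s + ?\<mu> + s + 1)))) = 1"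
        unfolding 1 unfolding 2 3 4 by (rule 5)
      then have "complex_of_real (?c * zernike_monomial_coeff ?\<mu> s 0 / a ^ (?\<mu> + 2 * s)) *
         of_real (2 * pi * ?c * a ^ (?\<mu> + 2 * s + 2) * (fact s * fact (s + ?\<mu>) / (2 * fact (s - s) * fact (s + ?\<mu> + s + 1)))) = 1"
        by (simp only: of_real_1 flip: of_real_mult)
      moreover have "inner_on (cball 0 a) (angular_monomial m s) ?V = of_real (2 * pi * ?c * a ^ (?\<mu> + 2 * s + 2) *
         (fact s * fact (s + ?\<mu>) / (2 * fact (s - s) * fact (s + ?\<mu> + s + 1))))"
        using zernike_moment[OF a, of m s m s] True by (simp only: simp_thms order_refl if_True)
      ultimately show ?thesis using True by (simp only: simp_thms if_True)
    qed (use that in \<open>auto simp: zernike_moment[OF a]\<close>)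
    finally show ?thesis .
  qed
  have "inner_on (cball 0 a) (zernike_fun a (m, nat \<bar>m\<bar> + 2 * s)) (zernike_fun a (m', nat \<bar>m'\<bar> + 2 * s'))
     = (if m = m' \<and> s = s' then 1 else 0)" for m m' s s'
  proof (cases "s \<le> s'")
    case False
    then show ?thesis using le[of s' s m' m]
      by (subst inner_on_commute) auto
  qed (rule le)
  then show ?thesis
    unfolding orthonormal_on_def
    by (auto simp: zernike_indices_iff continuous_on_zernike_fun)
qed

text \<open>
  The Zernike function with index \<open>l\<close> is a nonzero multiple of the monomial plus monomials
  of smaller \<open>l\<close>, so the triangular system can be solved.
\<close>

lemma angular_monomial_in_zernike_span:
  assumes a: "a > 0"
  shows "angular_monomial m l \<in> cspan (zernike_fun a ` (SIGMA m:UNIV. zernike_indices m))" (is "_ \<in> ?Z")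
proof (induction l rule: less_induct)
  case (less l)
  let ?n = "nat \<bar>m\<bar> + 2 * l"
  define k where "k j = complex_of_real (zernike_norm a ?n * zernike_monomial_coeff (nat \<bar>m\<bar>) l j / a ^ (nat \<bar>m\<bar> + 2 * (l - j)))" for j
  have k0: "k 0 \<noteq> 0"
  proof -
    have "real ?n + 1 > 0" by linarith
    then have "zernike_norm a ?n \<noteq> 0" using a by (simp add: zernike_norm_def del: of_nat_add)
    then show ?thesis using a by (simp add: k_def zernike_monomial_coeff_def)
  qed
  have V: "zernike_fun a (m, ?n) \<in> ?Z"
    by (intro cspan.base) (auto simp: zernike_indices_iff)
  have "zernike_fun a (m, ?n) x = (\<Sum>j\<le>l. k j * angular_monomial m (l - j) x)" for x
    unfolding k_def zernike_fun_eq ..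
  moreover have "(\<Sum>j\<le>l. k j * angular_monomial m (l - j) x)
      = k 0 * angular_monomial m l x + (\<Sum>j\<in>{1..l}. k j * angular_monomial m (l - j) x)" for x
    by (simp add: sum.atMost_shift atMost_atLeast0 sum.atLeast_Suc_atMost)
  ultimately have "angular_monomial m l x = (1 / k 0) * (zernike_fun a (m, ?n) x
       + (\<Sum>j\<in>{1..l}. (- k j) * angular_monomial m (l - j) x))" for x
    using k0 by (simp add: sum_negf)
  then have "angular_monomial m l = (\<lambda>x. (1 / k 0) * (zernike_fun a (m, ?n) x
       + (\<Sum>j\<in>{1..l}. (- k j) * angular_monomial m (l - j) x)))" by auto
  also have "\<dots> \<in> ?Z"
    by (intro cspan.scale cspan.add V cspan_sum less.IH) auto
  finally show ?case .
qed

lemma planar_monomial_eq_angular: "planar_monomial p q = angular_monomial (int p - int q) (min p q)"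
proof -
  have "nat (int p - int q) + min p q = p" "nat (- (int p - int q)) + min p q = q" by auto
  then show ?thesis by (simp add: angular_monomial_def)
qed

lemma zernike_complete:
  assumes a: "a > 0" and f: "continuous_on (cball 0 a) f"
  shows "approximable_on (cball 0 a) (zernike_fun a ` (SIGMA m:UNIV. zernike_indices m)) f"
  unfolding approximable_on_def
proof (intro allI impI)
  fix \<epsilon> :: real assume \<epsilon>: "\<epsilon> > 0"
  let ?G = "range (\<lambda>(p, q). planar_monomial p q)"
  have G: "planar_monomial p q \<in> cspan ?G" for p q
    by (rule cspan.base) (auto intro!: image_eqI[of _ _ "(p, q)"])
  obtain p where p: "p \<in> cspan ?G" "\<And>x. x \<in> cball 0 a \<Longrightarrow> cmod (f (id x) - p x) < \<epsilon>"
  proof (rule Stone_Weierstrass_cspan[where T = id and S = "cball 0 a" and H = f and G = ?G and \<epsilon> = \<epsilon>])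
    fix c :: complex
    have "(\<lambda>x. c * planar_monomial 0 0 x) \<in> cspan ?G" by (intro cspan.scale G)
    then show "(\<lambda>x. c) \<in> cspan ?G" by (simp add: planar_monomial_def)
  next
    fix g h :: "real \<times> real \<Rightarrow> complex" assume "g \<in> ?G" "h \<in> ?G"
    then obtain p q p' q' where "g = planar_monomial p q" "h = planar_monomial p' q'" by auto
    then have "(\<lambda>x. g x * h x) = planar_monomial (p + p') (q + q')"
      by (auto simp: planar_monomial_def power_add mult_ac)
    then show "(\<lambda>x. g x * h x) \<in> cspan ?G" by (simp add: G)
  next
    fix v :: "real \<times> real" assume "v \<in> Basis"
    then consider "v = (1, 0)" | "v = (0, 1)" by (auto simp: Basis_prod_def)
    then show "(\<lambda>x. complex_of_real (id x \<bullet> v)) \<in> cspan ?G"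
    proof cases
      case 1
      have "(\<lambda>x. complex_of_real (id x \<bullet> v)) = (\<lambda>x. 1 / 2 * (planar_monomial 1 0 x + planar_monomial 0 1 x))"
        by (auto simp: planar_monomial_def 1 complex_eq_iff)
      also have "\<dots> \<in> cspan ?G" by (intro cspan.scale cspan.add G)
      finally show ?thesis .
    next
      case 2
      have "(\<lambda>x. complex_of_real (id x \<bullet> v)) = (\<lambda>x. - \<i> / 2 * (planar_monomial 1 0 x + (- 1) * planar_monomial 0 1 x))"
        by (auto simp: planar_monomial_def 2 complex_eq_iff)
      also have "\<dots> \<in> cspan ?G" by (intro cspan.scale cspan.add G)
      finally show ?thesis .
    qed
  qed (use f \<epsilon> in \<open>auto simp: id_def\<close>)
  have "?G \<subseteq> cspan (zernike_fun a ` (SIGMA m:UNIV. zernike_indices m))"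
    using angular_monomial_in_zernike_span[OF a] by (auto simp: planar_monomial_eq_angular)
  then have "p \<in> cspan (zernike_fun a ` (SIGMA m:UNIV. zernike_indices m))"
    by (rule cspan_cspan[OF p(1)])
  then show "\<exists>p\<in>cspan (zernike_fun a ` (SIGMA m:UNIV. zernike_indices m)). \<forall>x\<in>cball 0 a. cmod (f x - p x) < \<epsilon>"
    using p(2) by (intro bexI[of _ p]) auto
qed

section \<open>Fourier series on the square\<close>

definition plane_wave :: "real \<Rightarrow> real \<Rightarrow> real \<times> real \<Rightarrow> complex" where
  "plane_wave u v x = exp (\<i> * of_real (u * fst x + v * snd x))"

lemma continuous_on_plane_wave [continuous_intros]: "continuous_on U (plane_wave u v)"
proof -
  have "continuous_on U (\<lambda>x. exp (\<i> * complex_of_real (u * fst x + v * snd x)))"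
    by (intro continuous_intros)
  then show ?thesis by (simp add: plane_wave_def[abs_def])
qed

lemma plane_wave_add: "plane_wave u v (x + y) = plane_wave u v x * plane_wave u v y"
  by (simp add: plane_wave_def algebra_simps flip: exp_add)

lemma integral_Times_continuous:
  fixes f :: "'a::euclidean_space \<times> 'b::euclidean_space \<Rightarrow> complex"
  assumes S: "compact S" and T: "compact T" and f: "continuous_on (S \<times> T) f"
  shows "(LBINT z:S \<times> T. f z) = (LBINT x:S. LBINT y:T. f (x, y))"
proof -
  let ?F = "\<lambda>x y. indicator (S \<times> T) (x, y) *\<^sub>R f (x, y)"
  have "integrable lborel (\<lambda>z. indicator (S \<times> T) z *\<^sub>R f z)"
    by (intro borel_integrable_compact compact_Times S T f)
  then have i: "integrable (lborel \<Otimes>\<^sub>M lborel) (case_prod ?F)"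
    by (simp add: lborel_prod case_prod_unfold)
  have "(LBINT z:S \<times> T. f z) = integral\<^sup>L (lborel \<Otimes>\<^sub>M lborel) (case_prod ?F)"
    by (simp add: lborel_prod case_prod_unfold set_lebesgue_integral_def)
  also have "\<dots> = (LBINT x. LBINT y. ?F x y)" by (rule lborel_pair.integral_fst[OF i, symmetric])
  also have "?F = (\<lambda>x y. indicator S x *\<^sub>R indicator T y *\<^sub>R f (x, y))"
    by (auto simp: indicator_def fun_eq_iff)
  finally show ?thesis
    by (simp only: set_lebesgue_integral_def Bochner_Integration.integral_scaleR_right)
qed

definition fourier_fun :: "real \<Rightarrow> int \<times> int \<Rightarrow> real \<times> real \<Rightarrow> complex" where
  "fourier_fun a k x = of_real (1 / (2 * a)) *
     plane_wave (pi / a * real_of_int (fst k)) (pi / a * real_of_int (snd k)) x"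

definition square :: "real \<Rightarrow> (real \<times> real) set" where
  "square a = {- a..a} \<times> {- a..a}"

lemma compact_square: "compact (square a)"
  unfolding square_def by (intro compact_Times compact_Icc)

lemma continuous_on_fourier_fun [continuous_intros]: "continuous_on U (fourier_fun a k)"
proof -
  have "continuous_on U (\<lambda>x. of_real (1 / (2 * a)) *
     plane_wave (pi / a * real_of_int (fst k)) (pi / a * real_of_int (snd k)) x)"
    by (intro continuous_intros)
  then show ?thesis by (simp add: fourier_fun_def[abs_def])
qed

lemma interval_wave_integral:
  assumes a: "a > 0"
  shows "(LBINT x:{-a..a}. exp (\<i> * of_int k * of_real (pi / a * x))) = (if k = 0 then 2 * of_real a else 0)"
proof (cases "k = 0")
  case True
  then show ?thesis using a by (simp add: set_lebesgue_integral_def scaleR_conv_of_real)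
next
  case False
  let ?F = "\<lambda>x. exp (\<i> * of_int k * of_real (pi / a * x)) / (\<i> * of_int k * of_real (pi / a))"
  have "((\<lambda>x. exp (\<i> * of_int k * of_real (pi / a * x))) has_integral ?F a - ?F (- a)) {-a..a}"
    using False a
    by (intro fundamental_theorem_of_calculus)
       (auto intro!: derivative_eq_intros has_vector_derivative_real_field simp: field_simps)
  moreover have "exp (\<i> * of_int k * of_real (pi / a * a)) = exp (\<i> * of_int k * of_real (pi / a * (- a)))"
  proof -
    have "exp (2 * of_real pi * \<i> * of_int k) = (1 :: complex)"
      using exp_integer_2pi[of "of_int k"] by (simp add: mult_ac)
    then have "exp (\<i> * of_int k * of_real pi) * exp (\<i> * of_int k * of_real pi) = (1 :: complex)"
      by (simp add: algebra_simps flip: exp_add)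
    then have "exp (\<i> * of_int k * of_real pi) = exp (- (\<i> * of_int k * of_real pi))"
      by (metis exp_minus_inverse mult_left_cancel exp_not_eq_zero)
    then show ?thesis using a by simp
  qed
  ultimately have "((\<lambda>x. exp (\<i> * of_int k * of_real (pi / a * x))) has_integral 0) {-a..a}" by simp
  then show ?thesis using False a
    by (subst set_borel_integral_eq_integral(2))
       (auto intro!: set_integrable_continuous_compact continuous_intros integral_unique)
qed

lemma fourier_orthonormal:
  assumes a: "a > 0"
  shows "orthonormal_on (square a) (fourier_fun a) UNIV"
  unfolding orthonormal_on_def
proof (intro conjI ballI)
  fix k l :: "int \<times> int"
  let ?E = "\<lambda>k x. exp (\<i> * of_int k * complex_of_real (pi / a * x))"
  have eq: "fourier_fun a k (x, y) * cnj (fourier_fun a l (x, y))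
     = ?E (fst k - fst l) x * ?E (snd k - snd l) y * of_real (1 / (4 * a\<^sup>2))" for x y
  proof -
    have 1: "plane_wave (pi / a * of_int (fst k)) (pi / a * of_int (snd k)) (x, y) *
        cnj (plane_wave (pi / a * of_int (fst l)) (pi / a * of_int (snd l)) (x, y))
      = ?E (fst k - fst l) x * ?E (snd k - snd l) y"
      unfolding plane_wave_def exp_cnj exp_add[symmetric] by (simp add: algebra_simps)
    have 2: "complex_of_real (1 / (2 * a)) * of_real (1 / (2 * a)) = of_real (1 / (4 * a\<^sup>2))"
      by (simp add: power2_eq_square)
    have rearrange: "(c * P) * (c * Q) = (P * Q) * (c * c)" for c P Q :: complex by (simp add: mult_ac)
    show ?thesis
      unfolding fourier_fun_def complex_cnj_mult complex_cnj_complex_of_real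
      by (rule trans[OF rearrange]) (simp only: 1 2)
  qed
  have "inner_on (square a) (fourier_fun a k) (fourier_fun a l)
     = (LBINT x:{-a..a}. LBINT y:{-a..a}. fourier_fun a k (x, y) * cnj (fourier_fun a l (x, y)))"
    unfolding inner_on_def square_def by (rule integral_Times_continuous) (auto intro!: continuous_intros)
  also have "\<dots> = (if k = l then 1 else 0)"
    unfolding eq using a
    by (simp only: set_integral_mult_left set_integral_mult_right interval_wave_integral)
       (auto simp: prod_eq_iff power2_eq_square)
  finally show "inner_on (square a) (fourier_fun a k) (fourier_fun a l) = (if k = l then 1 else 0)" .
qed (intro continuous_intros)

text \<open>A continuous map on a compact set is closed onto its image, hence a quotient map.\<close>

lemma continuous_factor_compact:
  fixes T :: "'a::t2_space \<Rightarrow> 'b::t2_space" and f :: "'a \<Rightarrow> 'c::topological_space"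
  assumes S: "compact S" and T: "continuous_on S T" and f: "continuous_on S f"
    and fib: "\<And>x y. x \<in> S \<Longrightarrow> y \<in> S \<Longrightarrow> T x = T y \<Longrightarrow> f x = f y"
  obtains H where "continuous_on (T ` S) H" "\<And>x. x \<in> S \<Longrightarrow> H (T x) = f x"
proof
  let ?H = "\<lambda>y. f (inv_into S T y)"
  show H: "?H (T x) = f x" if "x \<in> S" for x
    using that by (intro fib) (auto intro: inv_into_into f_inv_into_f)
  show "continuous_on (T ` S) ?H"
    unfolding continuous_on_closed_vimage[OF compact_imp_closed[OF compact_continuous_image[OF T S]]]
  proof (intro allI impI)
    fix B :: "'c set" assume "closed B"
    have "?H -` B \<inter> T ` S = T ` (f -` B \<inter> S)" using H by auto
    moreover have "compact (f -` B \<inter> S)"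
      using f S \<open>closed B\<close> by (metis compact_Int_closed continuous_on_closed_vimage compact_imp_closed inf.left_idem inf_commute)
    ultimately show "closed (?H -` B \<inter> T ` S)"
      using T by (metis compact_continuous_image compact_imp_closed continuous_on_subset inf_le2)
  qed
qed

text \<open>
  The map \<open>T\<close> wraps the square onto the torus and identifies exactly the opposite edges,
  so \<open>f\<close> becomes a continuous function on the torus, where polynomials in the coordinates
  are trigonometric polynomials.
\<close>

lemma fourier_complete:
  assumes a: "a > 0" and f: "continuous_on (square a) f"
    and per: "\<And>x. x \<in> {-a..a} \<Longrightarrow> f (x, - a) = f (x, a)" "\<And>y. y \<in> {-a..a} \<Longrightarrow> f (- a, y) = f (a, y)"
  shows "approximable_on (square a) (range (fourier_fun a)) f"
  unfolding approximable_on_def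
proof (intro allI impI)
  fix \<epsilon> :: real assume \<epsilon>: "\<epsilon> > 0"
  define w where "w j l = plane_wave (pi / a * real_of_int j) (pi / a * real_of_int l)" for j l
  define T where "T x = (cis (pi / a * fst x), cis (pi / a * snd x))" for x :: "real \<times> real"
  let ?G = "range (\<lambda>(j, l). w j l)"
  have G: "w j l \<in> cspan ?G" for j l
    by (rule cspan.base) (auto intro!: image_eqI[of _ _ "(j, l)"])
  have Tc: "continuous_on (square a) T" unfolding T_def by (intro continuous_intros)
  \<comment> \<open>Points of the interval with the same image on the circle are equal or the two endpoints.\<close>
  have same: "u = v \<or> u = - a \<and> v = a \<or> u = a \<and> v = - a"
    if "u \<in> {-a..a}" "v \<in> {-a..a}" "cis (pi / a * u) = cis (pi / a * v)" for u v
  proof -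
    have "exp (\<i> * of_real (pi / a * u)) = exp (\<i> * of_real (pi / a * v))"
      using that by (simp add: cis_conv_exp)
    then obtain n :: int where "\<i> * of_real (pi / a * u) = \<i> * of_real (pi / a * v) + of_int (2 * n) * of_real pi * \<i>"
      unfolding exp_eq by auto
    then have "pi / a * u = pi / a * v + of_int (2 * n) * pi"
      by (auto simp: complex_eq_iff)
    then have "pi * u = pi * (v + 2 * a * of_int n)" using a by (simp add: field_simps)
    then have n: "u = v + 2 * a * of_int n" by (simp only: mult_cancel_left) simp
    then have "\<bar>2 * a * real_of_int n\<bar> \<le> 2 * a * 1" using that by auto
    then have "\<bar>real_of_int n\<bar> \<le> 1" using a by (simp add: abs_mult)
    then have "n = -1 \<or> n = 0 \<or> n = 1" by linarith
    then show ?thesis using n that by auto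
  qed
  obtain H where H: "continuous_on (T ` square a) H" "\<And>x. x \<in> square a \<Longrightarrow> H (T x) = f x"
  proof (rule continuous_factor_compact[OF compact_square Tc f])
    fix x y assume *: "x \<in> square a" "y \<in> square a" "T x = T y"
    obtain u v where x: "x = (u, v)" by (cases x)
    obtain u' v' where y: "y = (u', v')" by (cases y)
    have uv: "u \<in> {-a..a}" "v \<in> {-a..a}" "u' \<in> {-a..a}" "v' \<in> {-a..a}" using * by (auto simp: x y square_def)
    have "f (u, v) = f (u', v)" using same[of u u'] uv * per(2)[of v] by (auto simp: x y T_def)
    moreover have "f (u', v) = f (u', v')" using same[of v v'] uv * per(1)[of u'] by (auto simp: x y T_def)
    ultimately show "f x = f y" by (simp add: x y)
  qed blast
  obtain p where p: "p \<in> cspan ?G" "\<And>x. x \<in> square a \<Longrightarrow> cmod (H (T x) - p x) < \<epsilon>"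
  proof (rule Stone_Weierstrass_cspan[OF _ H(1) \<epsilon>])
    show "compact (T ` square a)" by (intro compact_continuous_image Tc compact_square)
  next
    fix c :: complex
    have "(\<lambda>x. c * w 0 0 x) \<in> cspan ?G" by (intro cspan.scale G)
    then show "(\<lambda>x. c) \<in> cspan ?G" by (simp add: w_def plane_wave_def)
  next
    fix g h :: "real \<times> real \<Rightarrow> complex" assume "g \<in> ?G" "h \<in> ?G"
    then obtain j l j' l' where "g = w j l" "h = w j' l'" by auto
    then have "(\<lambda>x. g x * h x) = w (j + j') (l + l')"
      by (auto simp: w_def plane_wave_def algebra_simps simp flip: exp_add)
    then show "(\<lambda>x. g x * h x) \<in> cspan ?G" by (simp add: G)
  next
    fix v :: "complex \<times> complex" assume "v \<in> Basis"
    then consider "v = (1, 0)" | "v = (\<i>, 0)" | "v = (0, 1)" | "v = (0, \<i>)"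
      by (auto simp: Basis_prod_def Basis_complex_def)
    then show "(\<lambda>x. complex_of_real (T x \<bullet> v)) \<in> cspan ?G"
    proof cases
      case 1
      have "(\<lambda>x. complex_of_real (T x \<bullet> v)) = (\<lambda>x. 1 / 2 * (w 1 0 x + w (-1) 0 x))"
        by (auto simp: 1 T_def w_def plane_wave_def complex_eq_iff Re_exp Im_exp inner_complex_def)
      also have "\<dots> \<in> cspan ?G" by (intro cspan.scale cspan.add G)
      finally show ?thesis .
    next
      case 2
      have "(\<lambda>x. complex_of_real (T x \<bullet> v)) = (\<lambda>x. - \<i> / 2 * (w 1 0 x + (-1) * w (-1) 0 x))"
        by (auto simp: 2 T_def w_def plane_wave_def complex_eq_iff Re_exp Im_exp inner_complex_def)
      also have "\<dots> \<in> cspan ?G" by (intro cspan.scale cspan.add G)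
      finally show ?thesis .
    next
      case 3
      have "(\<lambda>x. complex_of_real (T x \<bullet> v)) = (\<lambda>x. 1 / 2 * (w 0 1 x + w 0 (-1) x))"
        by (auto simp: 3 T_def w_def plane_wave_def complex_eq_iff Re_exp Im_exp inner_complex_def)
      also have "\<dots> \<in> cspan ?G" by (intro cspan.scale cspan.add G)
      finally show ?thesis .
    next
      case 4
      have "(\<lambda>x. complex_of_real (T x \<bullet> v)) = (\<lambda>x. - \<i> / 2 * (w 0 1 x + (-1) * w 0 (-1) x))"
        by (auto simp: 4 T_def w_def plane_wave_def complex_eq_iff Re_exp Im_exp inner_complex_def)
      also have "\<dots> \<in> cspan ?G" by (intro cspan.scale cspan.add G)
      finally show ?thesis .
    qed
  qed blast
  have "w j l \<in> cspan (range (fourier_fun a))" for j l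
  proof -
    have "(\<lambda>x. of_real (2 * a) * fourier_fun a (j, l) x) \<in> cspan (range (fourier_fun a))"
      by (intro cspan.scale cspan.base) auto
    moreover have "(\<lambda>x. of_real (2 * a) * fourier_fun a (j, l) x) = w j l"
      using a by (auto simp: fourier_fun_def w_def)
    ultimately show ?thesis by simp
  qed
  then have "?G \<subseteq> cspan (range (fourier_fun a))" by auto
  then have "p \<in> cspan (range (fourier_fun a))" by (rule cspan_cspan[OF p(1)])
  then show "\<exists>p\<in>cspan (range (fourier_fun a)). \<forall>x\<in>square a. cmod (f x - p x) < \<epsilon>"
    using p(2) H(2) by (intro bexI[of _ p]) auto
qed

section \<open>Windowed convolutions\<close>

lemma zero_extension_props:
  assumes f: "continuous_on UNIV f"
  shows "zero_extension b f \<in> borel_measurable borel"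
    and "\<exists>B\<ge>0. \<forall>x. cmod (zero_extension b f x) \<le> B"
proof -
  have c: "continuous_on (cball 0 b) f" using f continuous_on_subset by blast
  have "zero_extension b f = (\<lambda>x. indicator (cball 0 b) x *\<^sub>R f x)"
    by (auto simp: zero_extension_def fun_eq_iff)
  then show "zero_extension b f \<in> borel_measurable borel"
    using borel_integrable_compact[OF compact_cball c] by (auto dest: borel_measurable_integrable)
  have "bounded (f ` cball 0 b)" by (intro compact_imp_bounded compact_continuous_image c compact_cball)
  then obtain B where "\<forall>x\<in>cball 0 b. cmod (f x) \<le> B" unfolding bounded_iff by blast
  then have "cmod (zero_extension b f x) \<le> max B 0" for x
    by (cases "x \<in> cball 0 b") (simp_all add: zero_extension_def le_max_iff_disj)
  then show "\<exists>B\<ge>0. \<forall>x. cmod (zero_extension b f x) \<le> B" by (intro exI[of _ "max B 0"]) auto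
qed

lemma isCont_zero_extension:
  assumes f: "continuous_on UNIV f" and x: "norm x \<noteq> b"
  shows "isCont (zero_extension b f) x"
proof (cases "norm x < b")
  case True
  have "eventually (\<lambda>y. y \<in> ball 0 b) (nhds x)"
    using True by (intro eventually_nhds_in_open) auto
  then have "eventually (\<lambda>y. zero_extension b f y = f y) (nhds x)"
    by eventually_elim (auto simp: zero_extension_def)
  then show ?thesis using f by (subst isCont_cong) (auto simp: continuous_on_eq_continuous_at simp del: split_paired_All)
next
  case False
  then have "x \<in> - cball 0 b" using x by auto
  then have "eventually (\<lambda>y. y \<in> - cball 0 b) (nhds x)"
    by (intro eventually_nhds_in_open) (auto intro: open_Compl)
  then have "eventually (\<lambda>y. zero_extension b f y = 0) (nhds x)"
    by eventually_elim (auto simp: zero_extension_def)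
  then show ?thesis by (subst isCont_cong) auto
qed

lemma windowed_convolution_eq_0:
  assumes "norm x > 2 * b"
  shows "windowed_convolution b f\<^sub>1 f\<^sub>2 x = 0"
proof -
  have "zero_extension b f\<^sub>1 y * zero_extension b f\<^sub>2 (x - y) = 0" for y
    using assms norm_triangle_ineq[of y "x - y"] by (auto simp: zero_extension_def)
  then have "(\<lambda>y. zero_extension b f\<^sub>1 y * zero_extension b f\<^sub>2 (x - y)) = (\<lambda>y. 0)" by (rule ext)
  then show ?thesis unfolding windowed_convolution_def convolution_def by (simp only: Bochner_Integration.integral_zero)
qed

text \<open>
  Dominated convergence: the zero extension of \<open>f\<^sub>2\<close> is continuous off the circle of
  radius \<open>b\<close>, and the points \<open>y\<close> with \<open>x - y\<close> on that circle form a null set.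
\<close>

lemma continuous_windowed_convolution:
  assumes f1: "continuous_on UNIV f\<^sub>1" and f2: "continuous_on UNIV f\<^sub>2"
  shows "continuous_on UNIV (windowed_convolution b f\<^sub>1 f\<^sub>2)"
proof -
  let ?E1 = "zero_extension b f\<^sub>1" and ?E2 = "zero_extension b f\<^sub>2"
  note [measurable] = zero_extension_props(1)[OF f1, of b] zero_extension_props(1)[OF f2, of b]
  obtain B1 where B1: "B1 \<ge> 0" "\<And>x. cmod (?E1 x) \<le> B1" using zero_extension_props(2)[OF f1] by blast
  obtain B2 where B2: "B2 \<ge> 0" "\<And>x. cmod (?E2 x) \<le> B2" using zero_extension_props(2)[OF f2] by blast
  show ?thesis
    unfolding continuous_on_sequentially
  proof (intro allI ballI impI, elim conjE)
    fix X :: "nat \<Rightarrow> real \<times> real" and x assume X: "X \<longlonglongrightarrow> x"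
    have "(\<lambda>n. LBINT y. ?E1 y * ?E2 (X n - y)) \<longlonglongrightarrow> (LBINT y. ?E1 y * ?E2 (x - y))"
    proof (rule integral_dominated_convergence[where w = "\<lambda>y. indicator (cball 0 b) y *\<^sub>R (B1 * B2)"])
      show "integrable lborel (\<lambda>y :: real \<times> real. indicator (cball 0 b) y *\<^sub>R (B1 * B2))"
        by (intro borel_integrable_compact compact_cball continuous_intros)
      have "sphere x b \<in> null_sets lborel"
        using negligible_sphere[of x b] by (auto simp: null_sets_completion_iff negligible_iff_null_sets)
      then have "AE y in lborel. y \<notin> sphere x b" by (rule AE_not_in)
      then show "AE y in lborel. (\<lambda>n. ?E1 y * ?E2 (X n - y)) \<longlonglongrightarrow> ?E1 y * ?E2 (x - y)"
      proof eventually_elim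
        case (elim y)
        then have "isCont ?E2 (x - y)" by (intro isCont_zero_extension f2) (auto simp: dist_norm)
        then have "(\<lambda>n. ?E2 (X n - y)) \<longlonglongrightarrow> ?E2 (x - y)"
          by (rule isCont_tendsto_compose) (intro tendsto_intros X)
        then show ?case by (intro tendsto_intros)
      qed
      show "AE y in lborel. norm (?E1 y * ?E2 (X n - y)) \<le> indicator (cball 0 b) y *\<^sub>R (B1 * B2)" for n
      proof (rule AE_I2)
        fix y
        show "norm (?E1 y * ?E2 (X n - y)) \<le> indicator (cball 0 b) y *\<^sub>R (B1 * B2)"
        proof (cases "y \<in> cball 0 b")
          case True
          have "cmod (?E1 y) * cmod (?E2 (X n - y)) \<le> B1 * B2" by (intro mult_mono B1 B2) auto
          then show ?thesis using True by (simp add: norm_mult)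
        qed (simp add: zero_extension_def)
      qed
    qed measurable
    then show "(windowed_convolution b f\<^sub>1 f\<^sub>2 \<circ> X) \<longlonglongrightarrow> windowed_convolution b f\<^sub>1 f\<^sub>2 x"
      by (simp add: windowed_convolution_def convolution_def o_def)
  qed
qed

text \<open>The value on the circle of radius \<open>2 * b\<close> is a limit of values outside.\<close>

lemma windowed_convolution_boundary:
  assumes f1: "continuous_on UNIV f\<^sub>1" and f2: "continuous_on UNIV f\<^sub>2" and x: "norm x \<ge> 2 * b"
  shows "windowed_convolution b f\<^sub>1 f\<^sub>2 x = 0"
proof -
  let ?F = "windowed_convolution b f\<^sub>1 f\<^sub>2"
  have "closed {x. ?F x = 0}"
    by (intro closed_Collect_eq continuous_windowed_convolution f1 f2 continuous_on_const)
  moreover have "- cball 0 (2 * b) \<subseteq> {x. ?F x = 0}" by (auto intro: windowed_convolution_eq_0)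
  ultimately have "closure (- cball 0 (2 * b)) \<subseteq> {x. ?F x = 0}" by (rule closure_minimal[rotated])
  then have "- ball 0 (2 * b) \<subseteq> {x. ?F x = 0}" by (simp add: closure_complement)
  moreover have "x \<in> - ball 0 (2 * b)" using x by simp
  ultimately show ?thesis by blast
qed

lemma disc_fourier_coeff_eq:
  assumes b: "b > 0" and f: "continuous_on UNIV f"
  shows "disc_fourier_coeff a b f k
     = (LBINT x. zero_extension b f x * cnj (plane_wave (pi / a * real_of_int (fst k)) (pi / a * real_of_int (snd k)) x))"
proof -
  let ?w = "plane_wave (pi / a * real_of_int (fst k)) (pi / a * real_of_int (snd k))"
  have c: "continuous_on (cball 0 b) f" using f continuous_on_subset by blast
  have "disc_fourier_coeff a b f k = (LBINT x:cball 0 b. f x * cnj (?w x))"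
    unfolding disc_fourier_coeff_def
  proof (subst disc_integral_polar[OF b])
    show "continuous_on (cball 0 b) (\<lambda>x. f x * cnj (?w x))" by (intro continuous_intros c)
    show "(LBINT r:{0..b}. LBINT \<theta>:{0..2 * pi}. polar f r \<theta>
        * exp (- of_real pi * \<i> * of_real (1 / a * r *
            (real_of_int (fst k) * cos \<theta> + real_of_int (snd k) * sin \<theta>)))
        * of_real r)
      = (LBINT r:{0..b}. LBINT \<theta>:{0..2 * pi}. f (r * cos \<theta>, r * sin \<theta>) * cnj (?w (r * cos \<theta>, r * sin \<theta>)) * of_real r)"
      by (simp add: polar_def plane_wave_def exp_cnj algebra_simps)
  qed
  also have "\<dots> = (LBINT x. zero_extension b f x * cnj (?w x))"
    unfolding set_lebesgue_integral_def
    by (intro Bochner_Integration.integral_cong) (auto simp: zero_extension_def)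
  finally show ?thesis .
qed

lemma lborel_integral_translate:
  fixes g :: "'a::euclidean_space \<Rightarrow> complex"
  assumes [measurable]: "g \<in> borel_measurable borel"
  shows "(LBINT x. g (x - y)) = (LBINT x. g x)"
proof -
  have "(LBINT x. g x) = (\<integral>x. g x \<partial>distr lborel borel ((+) (- y)))" by (simp add: lborel_distr_plus)
  also have "\<dots> = (LBINT x. g (x - y))" by (subst integral_distr) auto
  finally show ?thesis by simp
qed

lemma convolution_theorem:
  assumes b: "b > 0" and f1: "continuous_on UNIV f\<^sub>1" and f2: "continuous_on UNIV f\<^sub>2"
  shows "(LBINT x. windowed_convolution b f\<^sub>1 f\<^sub>2 x * cnj (plane_wave (pi / a * real_of_int (fst k)) (pi / a * real_of_int (snd k)) x))
     = disc_fourier_coeff a b f\<^sub>1 k * disc_fourier_coeff a b f\<^sub>2 k"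
proof -
  let ?w = "\<lambda>x. cnj (plane_wave (pi / a * real_of_int (fst k)) (pi / a * real_of_int (snd k)) x)"
  let ?E1 = "zero_extension b f\<^sub>1" and ?E2 = "zero_extension b f\<^sub>2"
  define h1 h2 where "h1 y = ?E1 y * ?w y" and "h2 y = ?E2 y * ?w y" for y
  have wm [measurable]: "?w \<in> borel_measurable borel"
    by (intro borel_measurable_continuous_onI continuous_intros)
  have h_meas [measurable]: "h1 \<in> borel_measurable borel" "h2 \<in> borel_measurable borel"
    unfolding h1_def h2_def using zero_extension_props(1)[OF f1, of b] zero_extension_props(1)[OF f2, of b]
    by measurable
  obtain B1 where B1: "B1 \<ge> 0" "\<And>x. cmod (?E1 x) \<le> B1" using zero_extension_props(2)[OF f1] by blast
  obtain B2 where B2: "B2 \<ge> 0" "\<And>x. cmod (?E2 x) \<le> B2" using zero_extension_props(2)[OF f2] by blast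
  have w1: "cmod (plane_wave u v x) = 1" for u v x by (simp add: plane_wave_def)
  have bounds: "cmod (h1 x) \<le> B1" "cmod (h2 x) \<le> B2" for x
    using B1(2)[of x] B2(2)[of x] by (simp_all add: h1_def h2_def norm_mult w1)
  \<comment> \<open>A plane wave is a character, so it can be distributed over the two factors.\<close>
  have split: "?E1 y * ?E2 (x - y) * ?w x = h1 y * h2 (x - y)" for x y
  proof -
    have "?w x = ?w y * ?w (x - y)"
      using plane_wave_add[of _ _ y "x - y"] by (metis complex_cnj_mult add_diff_cancel_left' add_diff_eq)
    then show ?thesis by (simp add: h1_def h2_def mult_ac)
  qed
  let ?h = "\<lambda>z. h1 (snd z) * h2 (fst z - snd z)"
  have int: "integrable (lborel :: ((real \<times> real) \<times> (real \<times> real)) measure) ?h"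
  proof (rule integrableI_bounded_set[where A = "cball 0 (2 * b) \<times> cball 0 b" and B = "B1 * B2"])
    have "(\<lambda>z. h2 (fst z - snd z)) \<in> borel_measurable (borel :: ((real \<times> real) \<times> (real \<times> real)) measure)"
      by (rule measurable_compose[OF _ h_meas(2)]) (intro borel_measurable_continuous_onI continuous_intros)
    moreover have "(\<lambda>z. h1 (snd z)) \<in> borel_measurable (borel :: ((real \<times> real) \<times> (real \<times> real)) measure)"
      by (rule measurable_compose[OF _ h_meas(1)]) (intro borel_measurable_continuous_onI continuous_intros)
    ultimately show "?h \<in> borel_measurable lborel" by simp
    show "emeasure lborel (cball (0 :: real \<times> real) (2 * b) \<times> cball (0 :: real \<times> real) b) < \<infinity>"
      by (intro emeasure_compact_finite compact_Times compact_cball)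
    show "AE z in lborel. z \<in> cball 0 (2 * b) \<times> cball 0 b \<longrightarrow> norm (?h z) \<le> B1 * B2"
      unfolding norm_mult using B1(1) by (intro AE_I2 impI mult_mono bounds) auto
    have "?h z = 0" if "z \<notin> cball 0 (2 * b) \<times> cball 0 b" for z
      using that norm_triangle_ineq[of "snd z" "fst z - snd z"]
      by (cases z) (auto simp: h1_def h2_def zero_extension_def)
    then show "AE z in lborel. z \<notin> cball 0 (2 * b) \<times> cball 0 b \<longrightarrow> ?h z = 0" by auto
  qed (auto intro!: borel_closed closed_Times)
  then have int': "integrable (lborel \<Otimes>\<^sub>M lborel) (\<lambda>(x, y). h1 y * h2 (x - y))"
    by (simp add: lborel_prod case_prod_unfold)
  have "(LBINT x. windowed_convolution b f\<^sub>1 f\<^sub>2 x * ?w x) = (LBINT x. LBINT y. h1 y * h2 (x - y))"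
    unfolding windowed_convolution_def convolution_def split[symmetric] by simp
  also have "\<dots> = (LBINT y. LBINT x. h1 y * h2 (x - y))"
    by (rule lborel_pair.Fubini_integral[OF int', symmetric])
  also have "\<dots> = (LBINT y. h1 y * (LBINT x. h2 x))"
    using lborel_integral_translate[OF h_meas(2)] by simp
  also have "\<dots> = (LBINT x. h1 x) * (LBINT x. h2 x)" by simp
  finally show ?thesis
    unfolding disc_fourier_coeff_eq[OF b f1] disc_fourier_coeff_eq[OF b f2] h1_def h2_def .
qed

section \<open>Zernike coefficients of plane waves\<close>

lemma inner_on_sums:
  fixes f :: "nat \<Rightarrow> real \<times> real \<Rightarrow> complex"
  assumes S: "compact S" and f: "\<And>N. continuous_on S (f N)" and g: "continuous_on S g"
    and M: "\<And>N x. x \<in> S \<Longrightarrow> cmod (f N x) \<le> M N" "summable M"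
  shows "(\<lambda>N. inner_on S (f N) g) sums inner_on S (\<lambda>x. \<Sum>N. f N x) g"
proof -
  let ?h = "\<lambda>N x. indicator S x *\<^sub>R (f N x * cnj (g x))"
  have int: "integrable lborel (?h N)" for N
    using inner_on_continuous_integrable[OF S f g] by (simp add: set_integrable_def)
  have sm: "summable (\<lambda>N. cmod (f N x))" if "x \<in> S" for x
    by (rule summable_comparison_test'[OF M(2), of 0]) (use M(1) that in auto)
  have "(\<lambda>N. integral\<^sup>L lborel (?h N)) sums (\<integral>x. (\<Sum>N. ?h N x) \<partial>lborel)"
  proof (rule sums_integral[OF int])
    show "AE x in lborel. summable (\<lambda>N. norm (?h N x))"
      using sm by (intro AE_I2) (auto simp: indicator_def norm_mult intro: summable_mult2)
    have ng: "integrable lborel (\<lambda>x. indicator S x *\<^sub>R cmod (g x))"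
      using set_integrable_continuous_compact[OF S continuous_on_norm[OF g]] by (simp add: set_integrable_def)
    have "norm (\<integral>x. norm (?h N x) \<partial>lborel) \<le> M N * (\<integral>x. indicator S x *\<^sub>R cmod (g x) \<partial>lborel)" for N
    proof -
      have "(\<integral>x. norm (?h N x) \<partial>lborel) \<le> (\<integral>x. M N * (indicator S x *\<^sub>R cmod (g x)) \<partial>lborel)"
        using M(1) by (intro integral_mono integrable_norm int integrable_mult_right ng)
           (auto simp: indicator_def norm_mult intro: mult_right_mono)
      then show ?thesis by simp
    qed
    then show "summable (\<lambda>N. \<integral>x. norm (?h N x) \<partial>lborel)"
      by (intro summable_comparison_test'[OF summable_mult2[OF M(2)], of 0]) auto
  qed
  also have "(\<integral>x. (\<Sum>N. ?h N x) \<partial>lborel) = inner_on S (\<lambda>x. \<Sum>N. f N x) g"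
    unfolding inner_on_def set_lebesgue_integral_def
  proof (rule Bochner_Integration.integral_cong[OF refl])
    fix x
    show "(\<Sum>N. ?h N x) = indicator S x *\<^sub>R ((\<Sum>N. f N x) * cnj (g x))"
      using suminf_mult2[OF summable_norm_cancel[OF sm[of x]], of "cnj (g x)"] by (auto simp: indicator_def)
  qed
  finally show ?thesis by (simp add: inner_on_def set_lebesgue_integral_def)
qed

text \<open>
  The two forms of the phase: the expansion yields \<open>\<i> ^ n\<close>, the weight is written with
  \<open>m\<close>.
\<close>

lemma imaginary_unit_power_zernike:
  "\<i> ^ (nat \<bar>m\<bar> + 2 * s) = \<i> powi m * (- 1) powi ((int (nat \<bar>m\<bar> + 2 * s) - m) div 2)"
proof (cases "m \<ge> 0")
  case True
  then have "(int (nat \<bar>m\<bar> + 2 * s) - m) div 2 = int s" by simp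
  then show ?thesis using True
    by (simp add: power_add power_mult power_int_def)
next
  case False
  then have "m = - int (nat (- m))" by simp
  then obtain k where k: "m = - int k" by blast
  have d: "(int (nat \<bar>m\<bar> + 2 * s) - m) div 2 = int (k + s)" by (simp add: k)
  have "\<i> ^ k = inverse (\<i> ^ k) * (- 1) ^ k"
  proof -
    have "\<i> ^ k * \<i> ^ k = (- 1) ^ k" by (simp flip: power_mult_distrib)
    then show ?thesis by (simp add: field_simps)
  qed
  then show ?thesis unfolding d
    by (simp add: k power_add power_mult power_int_minus del: of_nat_add)
qed

text \<open>
  The phase is \<open>(cnj \<kappa> * z + \<kappa> * cnj z) / 2\<close> with the frequency \<open>\<kappa>\<close> read as a complex
  number, so the binomial theorem gives monomials.
\<close>

lemma plane_wave_term:
  fixes \<rho> \<phi> :: real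
  shows "(\<i> * of_real (\<rho> * cos \<phi> * fst x + \<rho> * sin \<phi> * snd x)) ^ N / fact N
    = (\<Sum>p\<le>N. (\<i> / 2) ^ N * cnj (planar_monomial p (N - p) (\<rho> * cos \<phi>, \<rho> * sin \<phi>)) / (fact p * fact (N - p))
         * planar_monomial p (N - p) x)"
proof -
  define \<kappa> where "\<kappa> = Complex (\<rho> * cos \<phi>) (\<rho> * sin \<phi>)"
  define z where "z = Complex (fst x) (snd x)"
  have "\<i> * of_real (\<rho> * cos \<phi> * fst x + \<rho> * sin \<phi> * snd x) = \<i> / 2 * (cnj \<kappa> * z + \<kappa> * cnj z)"
    by (simp add: \<kappa>_def z_def complex_eq_iff algebra_simps flip: add_divide_distrib)
  then have "(\<i> * of_real (\<rho> * cos \<phi> * fst x + \<rho> * sin \<phi> * snd x)) ^ N / fact N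
      = (\<i> / 2) ^ N * (cnj \<kappa> * z + \<kappa> * cnj z) ^ N / fact N"
    by (simp only: power_mult_distrib)
  also have "\<dots> = (\<Sum>p\<le>N. (\<i> / 2) ^ N * (of_nat (N choose p) * (cnj \<kappa> * z) ^ p * (\<kappa> * cnj z) ^ (N - p)) / fact N)"
    by (simp only: binomial_ring sum_distrib_left sum_divide_distrib)
  also have "\<dots> = (\<Sum>p\<le>N. (\<i> / 2) ^ N * cnj (planar_monomial p (N - p) (\<rho> * cos \<phi>, \<rho> * sin \<phi>)) / (fact p * fact (N - p))
         * planar_monomial p (N - p) x)"
  proof (intro sum.cong refl)
    fix p assume "p \<in> {..N}"
    then have "of_nat (N choose p) / fact N = (1 / (fact p * fact (N - p)) :: complex)"
      by (subst binomial_fact) auto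
    moreover have "(\<i> / 2) ^ N * (of_nat (N choose p) * P * Q) / fact N = (\<i> / 2) ^ N * P * Q * (of_nat (N choose p) / fact N)"
      for P Q by simp
    ultimately show "(\<i> / 2) ^ N * (of_nat (N choose p) * (cnj \<kappa> * z) ^ p * (\<kappa> * cnj z) ^ (N - p)) / fact N
       = (\<i> / 2) ^ N * cnj (planar_monomial p (N - p) (\<rho> * cos \<phi>, \<rho> * sin \<phi>)) / (fact p * fact (N - p))
         * planar_monomial p (N - p) x"
      by (simp add: planar_monomial_def power_mult_distrib flip: \<kappa>_def z_def)
  qed
  finally show ?thesis .
qed

text \<open>
  Integrate the exponential series term by term. The term of degree \<open>N\<close> contains only
  monomials with \<open>p + q = N\<close>, and only the one with \<open>p - q = m\<close> can contribute; by the
  moment formula it does so just for \<open>N = n + 2 * j\<close>. The factorials of the exponential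
  series cancel those of the moment, leaving the coefficients of the Bessel series.
\<close>

lemma plane_wave_zernike_sums:
  fixes \<rho> \<phi> :: real and m :: int and s :: nat
  assumes a: "a > 0"
  defines "n \<equiv> nat \<bar>m\<bar> + 2 * s"
  shows "(\<lambda>j. \<i> ^ n * exp (- \<i> * of_int m * of_real \<phi>) * of_real (pi * zernike_norm a n * a\<^sup>2) *
            of_real ((-1) ^ j / (fact j * fact (j + (n + 1))) * (a * \<rho> / 2) ^ (2 * j + n)))
         sums inner_on (cball 0 a) (plane_wave (\<rho> * cos \<phi>) (\<rho> * sin \<phi>)) (zernike_fun a (m, n))"
proof -
  let ?S = "cball (0 :: real \<times> real) a" let ?V = "zernike_fun a (m, n)" let ?\<mu> = "nat \<bar>m\<bar>"
  let ?u = "\<lambda>x. \<i> * complex_of_real (\<rho> * cos \<phi> * fst x + \<rho> * sin \<phi> * snd x)"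
  have Vc: "continuous_on ?S ?V" by (intro continuous_on_zernike_fun) (auto simp: zernike_indices_iff n_def)
  have uc: "continuous_on ?S ?u" by (intro continuous_intros)
  then have "bounded (?u ` ?S)" by (intro compact_imp_bounded compact_continuous_image compact_cball)
  then obtain R where R: "\<And>x. x \<in> ?S \<Longrightarrow> cmod (?u x) \<le> R"
    unfolding bounded_iff by blast
  define T where "T N = inner_on ?S (\<lambda>x. ?u x ^ N / fact N) ?V" for N
  have "T sums inner_on ?S (\<lambda>x. \<Sum>N. ?u x ^ N / fact N) ?V"
    unfolding T_def
  proof (rule inner_on_sums)
    show "summable (\<lambda>N. R ^ N / fact N)"
      using summable_exp[of R] by (simp add: field_simps)
    show "cmod (?u x ^ N / fact N) \<le> R ^ N / fact N" if "x \<in> ?S" for N x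
    proof -
      have "cmod (?u x) ^ N \<le> R ^ N" by (intro power_mono R that) auto
      then show ?thesis by (simp add: norm_divide norm_power divide_right_mono)
    qed
  qed (intro compact_cball Vc continuous_intros; simp)+
  also have "(\<lambda>x. \<Sum>N. ?u x ^ N / fact N) = plane_wave (\<rho> * cos \<phi>) (\<rho> * sin \<phi>)"
    by (rule ext) (simp add: plane_wave_def exp_def scaleR_conv_of_real field_simps)
  finally have T_sums: "T sums inner_on ?S (plane_wave (\<rho> * cos \<phi>) (\<rho> * sin \<phi>)) ?V" .

  define w where "w p q = cnj (planar_monomial p q (\<rho> * cos \<phi>, \<rho> * sin \<phi>)) / (fact p * fact q)" for p q
  have T_eq: "T N = (\<Sum>p\<le>N. (\<i> / 2) ^ N * w p (N - p) * inner_on ?S (planar_monomial p (N - p)) ?V)" for N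
    unfolding T_def plane_wave_term w_def using Vc
    by (subst inner_on_sum_left)
       (simp_all only: compact_cball inner_on_scale_left times_divide_eq_right,
        (intro continuous_intros; simp)+)
  have mom: "inner_on ?S (planar_monomial p q) ?V = 0" if "int p - int q \<noteq> m \<or> min p q < s" for p q
    using that unfolding planar_monomial_eq_angular n_def zernike_moment[OF a] by auto
  have T0: "T N = 0" if N: "N \<notin> range (\<lambda>j. n + 2 * j)" for N
    unfolding T_eq
  proof (intro sum.neutral ballI)
    fix p assume p: "p \<in> {..N}"
    have "int p - int (N - p) \<noteq> m \<or> min p (N - p) < s"
    proof (rule ccontr)
      assume "\<not> ?thesis"
      then have m: "int p - int (N - p) = m" and "s \<le> min p (N - p)" by auto
      then obtain j where "min p (N - p) = s + j" using le_Suc_ex by blast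
      then have "N = n + 2 * j" using p m unfolding n_def by (auto simp: min_def split: if_splits)
      then show False using N by auto
    qed
    then show "(\<i> / 2) ^ N * w p (N - p) * inner_on ?S (planar_monomial p (N - p)) ?V = 0" by (simp add: mom)
  qed
  have T1: "T (n + 2 * j) = \<i> ^ n * exp (- \<i> * of_int m * of_real \<phi>) * of_real (pi * zernike_norm a n * a\<^sup>2) *
            of_real ((-1) ^ j / (fact j * fact (j + (n + 1))) * (a * \<rho> / 2) ^ (2 * j + n))" for j
  proof -
    \<comment> \<open>The exponents of the only monomial of degree \<open>n + 2 * j\<close> with angular frequency \<open>m\<close>.\<close>
    define l p q where "l = s + j" and "p = nat m + l" and "q = nat (- m) + l"
    let ?N = "n + 2 * j"
    have pq: "?N - p = q" "p \<le> ?N" "planar_monomial p q = angular_monomial m l"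
      unfolding n_def p_def q_def l_def angular_monomial_def by (auto simp: abs_if)
    have "T ?N = (\<Sum>r\<le>?N. if r = p then (\<i> / 2) ^ ?N * w p q * inner_on ?S (planar_monomial p q) ?V else 0)"
      unfolding T_eq
    proof (intro sum.cong refl)
      fix r assume r: "r \<in> {..?N}"
      have "inner_on ?S (planar_monomial r (?N - r)) ?V = 0" if "r \<noteq> p"
      proof (rule mom, rule ccontr)
        assume "\<not> (int r - int (?N - r) \<noteq> m \<or> min r (?N - r) < s)"
        then have "int r - int (?N - r) = m" by auto
        with r have "r = p" unfolding p_def l_def n_def by (auto simp: abs_if split: if_splits)
        with that show False by simp
      qed
      then show "(\<i> / 2) ^ ?N * w r (?N - r) * inner_on ?S (planar_monomial r (?N - r)) ?V
        = (if r = p then (\<i> / 2) ^ ?N * w p q * inner_on ?S (planar_monomial p q) ?V else 0)"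
        using pq by auto
    qed
    also have "\<dots> = (\<i> / 2) ^ ?N * w p q * inner_on ?S (angular_monomial m l) ?V"
      using pq by simp
    also have "w p q = of_real \<rho> ^ ?N * exp (- \<i> * of_int m * of_real \<phi>) / (fact l * fact (l + ?\<mu>))"
    proof -
      have "fact p * fact q = (fact l * fact (l + ?\<mu>) :: complex)"
        by (auto simp: p_def q_def abs_if add.commute)
      moreover have "?\<mu> + 2 * l = ?N" by (simp add: l_def n_def)
      ultimately show ?thesis unfolding w_def pq angular_monomial_polar
        by (simp add: exp_cnj)
    qed
    also have "inner_on ?S (angular_monomial m l) ?V = of_real (2 * pi * zernike_norm a n * a ^ (?N + 2)
              * (fact l * fact (l + ?\<mu>) / (2 * fact j * fact (j + (n + 1)))))"
    proof -
      have "?\<mu> + 2 * l + 2 = ?N + 2" "l - s = j" "l + ?\<mu> + s + 1 = j + (n + 1)" "s \<le> l" by (auto simp: l_def n_def)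
      then show ?thesis using zernike_moment[OF a, of m l m s] by (simp only: n_def simp_thms if_True)
    qed
    also have "(\<i> / 2) ^ ?N * (of_real \<rho> ^ ?N * exp (- \<i> * of_int m * of_real \<phi>) / (fact l * fact (l + ?\<mu>))) *
       complex_of_real (2 * pi * zernike_norm a n * a ^ (?N + 2)
              * (fact l * fact (l + ?\<mu>) / (2 * fact j * fact (j + (n + 1)))))
      = \<i> ^ ?N * exp (- \<i> * of_int m * of_real \<phi>) * of_real (pi * zernike_norm a n * a\<^sup>2) *
         of_real (1 / (fact j * fact (j + (n + 1))) * (a * \<rho> / 2) ^ ?N)"
    proof -
      have aux: "(I / H) * (P * E / (f * g)) * (2 * p * c * (A * A2) * (f * g / (2 * u * v)))
        = I * E * (p * c * A2) * (1 / (u * v) * (A * P / H))"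
        if "f \<noteq> 0" "g \<noteq> 0" for I H P E f g p c A A2 u v :: complex
        using that by (simp add: field_simps)
      have "fact l \<noteq> (0 :: complex)" "fact (l + ?\<mu>) \<noteq> (0 :: complex)" by simp_all
      from aux[OF this, of "\<i> ^ ?N" "2 ^ ?N" "of_real \<rho> ^ ?N" "exp (- \<i> * of_int m * of_real \<phi>)" "of_real pi"
         "of_real (zernike_norm a n)" "of_real a ^ ?N" "of_real a ^ 2" "fact j" "fact (j + (n + 1))"]
      show ?thesis
        by (simp only: of_real_mult of_real_divide of_real_power of_real_fact of_real_numeral of_real_1
             power_add[of _ ?N 2] power_divide power_mult_distrib)
    qed
    also have "\<i> ^ ?N = \<i> ^ n * of_real ((-1) ^ j)" by (simp add: power_add power_mult)
    finally show ?thesis by (simp add: mult_ac add.commute)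
  qed
  have "strict_mono (\<lambda>j. n + 2 * j)" by (auto simp: strict_mono_def)
  then have "(\<lambda>j. T (n + 2 * j)) sums inner_on ?S (plane_wave (\<rho> * cos \<phi>) (\<rho> * sin \<phi>)) ?V"
    using sums_mono_reindex[of "\<lambda>j. n + 2 * j" T] T0 T_sums by blast
  then show ?thesis unfolding T1 .
qed

text \<open>
  The series sums to \<open>2 / \<pi>\<close> times the quotient of the Bessel function by the norm of \<open>k\<close>;
  for \<open>k = 0\<close> only its constant term can be nonzero, and it is so only for \<open>n = 0\<close>.
\<close>

lemma plane_wave_zernike:
  assumes a: "a > 0" and n: "n \<in> zernike_indices m"
  shows "inner_on (cball 0 a) (plane_wave (pi / a * real_of_int (fst k)) (pi / a * real_of_int (snd k))) (zernike_fun a (m, n))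
       = of_real (4 * a\<^sup>2) * conv_weight a k n m"
proof -
  obtain s where s: "n = nat \<bar>m\<bar> + 2 * s" using n by (auto simp: zernike_indices_iff)
  define L where "L = norm (lattice_point k)"
  define \<rho> where "\<rho> = pi / a * L"
  define \<phi> where "\<phi> = polar_angle (lattice_point k)"
  let ?t = "\<lambda>j. (-1) ^ j / (fact j * fact (j + (n + 1))) * (a * \<rho> / 2) ^ (2 * j + n)"
  let ?C = "\<i> ^ n * exp (- \<i> * of_int m * of_real \<phi>) * of_real (pi * zernike_norm a n * a\<^sup>2)"
  let ?W = "inner_on (cball 0 a) (plane_wave (pi / a * real_of_int (fst k)) (pi / a * real_of_int (snd k))) (zernike_fun a (m, n))"
  have a\<rho>: "a * \<rho> = pi * L" using a by (simp add: \<rho>_def)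
  have "lattice_point k = (L * cos \<phi>, L * sin \<phi>)"
    unfolding L_def \<phi>_def by (rule polar_decomposition)
  then have k: "pi / a * real_of_int (fst k) = \<rho> * cos \<phi>" "pi / a * real_of_int (snd k) = \<rho> * sin \<phi>"
    by (auto simp: lattice_point_def \<rho>_def)
  have W: "(\<lambda>j. ?C * of_real (?t j)) sums ?W"
    using plane_wave_zernike_sums[OF a, of m s \<phi> \<rho>] unfolding k s .
  have t: "?t sums (2 / pi * bessel_quotient n k)"
  proof (cases "k = 0")
    case True
    then have "\<rho> = 0" by (simp add: \<rho>_def L_def lattice_point_def)
    then have t: "?t = (\<lambda>j. if j = 0 then (if n = 0 then 1 else 0) else 0)"
      by (auto simp: fun_eq_iff power_0_left)
    have q: "2 / pi * bessel_quotient n k = (if n = 0 then 1 else 0)"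
      using True by (simp add: bessel_quotient_def)
    show ?thesis unfolding t q by (rule sums_single)
  next
    case False
    then have "L \<noteq> 0" by (auto simp: L_def lattice_point_def prod_eq_iff)
    then have x: "pi * L / 2 \<noteq> 0" by simp
    have C0: "?C \<noteq> 0"
    proof -
      have "real n + 1 > 0" by linarith
      then show ?thesis using a by (simp add: zernike_norm_def)
    qed
    have "summable (\<lambda>j. ?C * of_real (?t j))" using W by (rule sums_summable)
    then have "summable (\<lambda>j. complex_of_real (?t j))" using C0 by (rule summable_mult_D)
    then have "summable ?t" by (simp only: summable_of_real_iff)
    then have "?t sums (\<Sum>j. ?t j)" by (rule summable_sums)
    moreover have "bessel_J (n + 1) (pi * L) = (\<Sum>j. ?t j) * (pi * L / 2)"
    proof -
      have "?t j * (pi * L / 2) = (-1) ^ j / (fact j * fact (j + (n + 1))) * (pi * L / 2) ^ (2 * j + (n + 1))" for j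
        by (simp add: a\<rho>)
      then have "bessel_J (n + 1) (pi * L) = (\<Sum>j. ?t j * (pi * L / 2))"
        by (simp only: bessel_J_def)
      also have "\<dots> = (\<Sum>j. ?t j) * (pi * L / 2)" by (rule suminf_mult2[OF \<open>summable ?t\<close>, symmetric])
      finally show ?thesis .
    qed
    ultimately show ?thesis
    proof -
      assume b: "bessel_J (n + 1) (pi * L) = (\<Sum>j. ?t j) * (pi * L / 2)" and t: "?t sums (\<Sum>j. ?t j)"
      have "2 / pi * (A * (pi * L / 2) / L) = A" for A using \<open>L \<noteq> 0\<close> by simp
      then have "2 / pi * bessel_quotient n k = (\<Sum>j. ?t j)"
        using False by (simp only: bessel_quotient_def b flip: L_def) (simp only: if_False)
      then show ?thesis using t by (simp only:)
    qed
  qed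
  have "(\<lambda>j. ?C * of_real (?t j)) sums (?C * of_real (2 / pi * bessel_quotient n k))"
    by (intro sums_mult sums_of_real t)
  then have "?W = ?C * of_real (2 / pi * bessel_quotient n k)"
    using W sums_unique2 by blast
  also have "\<dots> = of_real (4 * a\<^sup>2) * conv_weight a k n m"
  proof -
    have "pi * zernike_norm a n * a\<^sup>2 * (2 / pi * bessel_quotient n k)
        = 4 * a\<^sup>2 * (sqrt (real n + 1) * bessel_quotient n k / (2 * a * sqrt pi))"
      using a by (simp add: zernike_norm_def power2_eq_square real_sqrt_divide)
    then have "complex_of_real (pi * zernike_norm a n * a\<^sup>2) * of_real (2 / pi * bessel_quotient n k)
        = of_real (4 * a\<^sup>2) * of_real (sqrt (real n + 1) * bessel_quotient n k / (2 * a * sqrt pi))"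
      by (simp only: flip: of_real_mult)
    moreover have "conv_weight a k n m = \<i> ^ n * exp (- \<i> * of_int m * of_real \<phi>) *
       of_real (sqrt (real n + 1) * bessel_quotient n k / (2 * a * sqrt pi))"
      unfolding conv_weight_def s imaginary_unit_power_zernike \<phi>_def by simp
    moreover have "P * K * B = A * (P * C)" if "K * B = A * C" for P K B A C :: complex
      using that by (metis mult.assoc mult.left_commute)
    ultimately show ?thesis by (simp only:)
  qed
  finally show ?thesis .
qed

section \<open>Angular components and the expansion\<close>

text \<open>
  The orthogonal projection onto functions of the form \<open>h r * exp (\<i> m \<theta>)\<close>, written as a
  Fourier integral over rotations so that it is continuous at the origin.
\<close>

definition angular_component :: "int \<Rightarrow> (real \<times> real \<Rightarrow> complex) \<Rightarrow> real \<times> real \<Rightarrow> complex" where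
  "angular_component m f x =
     of_real (1 / (2 * pi)) * (LBINT t:{0..2 * pi}. exp (\<i> * of_int (- m) * of_real t) * f (rot t x))"

lemma continuous_on_rotated:
  assumes f: "continuous_on (cball 0 a) f"
  shows "continuous_on (cball 0 a \<times> U) (\<lambda>z. f (rot (snd z) (fst z)))"
  by (rule continuous_on_compose2[OF f]) (auto intro!: continuous_intros simp: norm_rot)

lemma continuous_on_angular_component:
  assumes f: "continuous_on (cball 0 a) f"
  shows "continuous_on (cball 0 a) (angular_component m f)"
proof -
  have "continuous_on (cball 0 a \<times> {0..2 * pi}) (\<lambda>z. exp (\<i> * of_int (- m) * of_real (snd z)) * f (rot (snd z) (fst z)))"
    by (intro continuous_intros continuous_on_rotated f)
  then have "continuous_on (cball 0 a) (\<lambda>x. LBINT t:{0..2 * pi}. exp (\<i> * of_int (- m) * of_real t) * f (rot t x))"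
    by (intro continuous_on_parametric_integral) (simp only: case_prod_unfold)
  then have "continuous_on (cball 0 a) (\<lambda>x. of_real (1 / (2 * pi)) * (LBINT t:{0..2 * pi}. exp (\<i> * of_int (- m) * of_real t) * f (rot t x)))"
    by (intro continuous_intros)
  then show ?thesis by (simp only: angular_component_def[abs_def])
qed

lemma zernike_fun_rot:
  assumes n: "n \<in> zernike_indices m"
  shows "zernike_fun a (m, n) (rot t x) = exp (\<i> * of_int m * of_real t) * zernike_fun a (m, n) x"
proof -
  obtain r \<phi> where x: "x = (r * cos \<phi>, r * sin \<phi>)" using polar_decomposition by blast
  have "rot t x = (r * cos (t + \<phi>), r * sin (t + \<phi>))"
    by (simp add: x rot_def cos_add sin_add algebra_simps)
  then have "zernike_fun a (m, n) (rot t x) = zernike a n m r (t + \<phi>)"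
    by (simp add: zernike_fun_polar[OF n])
  also have "\<dots> = exp (\<i> * of_int m * of_real t) * zernike a n m r \<phi>"
    by (simp add: zernike_def algebra_simps exp_add)
  finally show ?thesis by (simp add: x zernike_fun_polar[OF n])
qed

text \<open>
  Interchange the integrals, move the rotation from \<open>f\<close> to the Zernike function, where it
  acts as the character \<open>exp (\<i> m' t)\<close>, and use orthogonality of characters.
\<close>

lemma inner_on_angular_component:
  assumes f: "continuous_on (cball 0 a) f" and n: "n \<in> zernike_indices m'"
  shows "inner_on (cball 0 a) (angular_component m f) (zernike_fun a (m', n))
       = (if m = m' then inner_on (cball 0 a) f (zernike_fun a (m', n)) else 0)"
proof -
  let ?S = "cball (0 :: real \<times> real) a" let ?V = "zernike_fun a (m', n)"
  let ?e = "\<lambda>t. exp (\<i> * of_int (- m) * complex_of_real t)"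
  have Vc: "continuous_on U ?V" for U by (rule continuous_on_zernike_fun[OF n])
  have "inner_on ?S (angular_component m f) ?V
     = (LBINT x:?S. LBINT t:{0..2 * pi}. of_real (1 / (2 * pi)) * (?e t * f (rot t x)) * cnj (?V x))"
    unfolding inner_on_def angular_component_def by (simp only: set_integral_mult_right set_integral_mult_left)
  also have "\<dots> = (LBINT t:{0..2 * pi}. LBINT x:?S. of_real (1 / (2 * pi)) * (?e t * f (rot t x)) * cnj (?V x))"
  proof (rule Fubini_compact)
    have Vf: "continuous_on (?S \<times> {0..2 * pi}) (\<lambda>z. ?V (fst z))"
      by (rule continuous_on_compose2[OF Vc[of UNIV]]) (auto intro: continuous_intros)
    have "continuous_on (?S \<times> {0..2 * pi}) (\<lambda>z. of_real (1 / (2 * pi)) * (?e (snd z) * f (rot (snd z) (fst z))) * cnj (?V (fst z)))"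
      by (intro continuous_intros continuous_on_rotated f Vf)
    then show "continuous_on (?S \<times> {0..2 * pi}) (\<lambda>(x, t). of_real (1 / (2 * pi)) * (?e t * f (rot t x)) * cnj (?V x))"
      by (simp only: case_prod_unfold)
  qed auto
  also have "\<dots> = (LBINT t:{0..2 * pi}. of_real (1 / (2 * pi)) * exp (\<i> * of_int (m' - m) * of_real t) * inner_on ?S f ?V)"
  proof -
    have "of_real (1 / (2 * pi)) * (?e t * f (rot t x)) * cnj (?V x)
       = of_real (1 / (2 * pi)) * exp (\<i> * of_int (m' - m) * of_real t) * (f (rot t x) * cnj (?V (rot t x)))" for t x
    proof -
      have e: "exp (\<i> * of_int (m' - m) * of_real t) * cnj (exp (\<i> * of_int m' * of_real t)) = ?e t"
        by (simp add: exp_cnj algebra_simps flip: exp_add)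
      have rearrange: "A * ((B * U) * C) * W = A * B * (C * (U * W))" for A B C U W :: complex
        by (simp add: mult_ac)
      show ?thesis unfolding zernike_fun_rot[OF n] complex_cnj_mult e[symmetric] by (rule rearrange)
    qed
    then have "(LBINT x:?S. of_real (1 / (2 * pi)) * (?e t * f (rot t x)) * cnj (?V x))
       = of_real (1 / (2 * pi)) * exp (\<i> * of_int (m' - m) * of_real t) * (LBINT x:?S. f (rot t x) * cnj (?V (rot t x)))" for t
      by (simp only: set_integral_mult_right)
    moreover have "(LBINT x:?S. f (rot t x) * cnj (?V (rot t x))) = inner_on ?S f ?V" for t
      unfolding inner_on_def by (rule disc_integral_rot[of a "\<lambda>x. f x * cnj (?V x)"]) (intro continuous_intros f Vc)
    ultimately show ?thesis by simp
  qed
  also have "\<dots> = (if m = m' then inner_on ?S f ?V else 0)"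
    by (simp only: set_integral_mult_right set_integral_mult_left angular_integral) simp
  finally show ?thesis .
qed

lemma has_L2_sumI:
  assumes S: "compact S" and u: "\<And>i. i \<in> I \<Longrightarrow> continuous_on S (u i)" and F: "continuous_on S F"
    and lim: "\<And>\<epsilon>. \<epsilon> > 0 \<Longrightarrow> \<exists>X. finite X \<and> X \<subseteq> I \<and>
      (\<forall>A. finite A \<and> X \<subseteq> A \<and> A \<subseteq> I \<longrightarrow> L2_norm_on S (\<lambda>x. F x - (\<Sum>i\<in>A. u i x)) < \<epsilon>)"
  shows "has_L2_sum S u I F"
  unfolding has_L2_sum_def
proof (intro conjI ballI)
  show "((\<lambda>A. L2_norm_on S (\<lambda>x. F x - (\<Sum>i\<in>A. u i x))) \<longlongrightarrow> 0) (finite_subsets_at_top I)"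
    unfolding tendsto_iff eventually_finite_subsets_at_top
    using lim by (simp add: L2_norm_on_nonneg)
qed (intro in_L2_on_continuous S u F; assumption)+

text \<open>
  Apply completeness to the angular component. A large finite set of pairs \<open>(m', n)\<close> may
  be enlarged by arbitrary pairs with \<open>m' = m\<close>, and those with \<open>m' \<noteq> m\<close> contribute
  nothing.
\<close>

lemma zernike_inner_sum:
  assumes a: "a > 0" and F: "continuous_on (cball 0 a) F"
  shows "has_L2_sum (cball 0 a) (\<lambda>n x. zernike_coeff a n m F * zernike a n m (norm x) (polar_angle x))
           (zernike_indices m) (angular_component m F)"
proof (rule has_L2_sumI)
  let ?S = "cball (0 :: real \<times> real) a" and ?I = "SIGMA m:UNIV. zernike_indices m" and ?g = "angular_component m F"
  have V: "(\<lambda>x. zernike a n m (norm x) (polar_angle x)) = zernike_fun a (m, n)" for n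
    by (simp add: zernike_fun_def)
  have gc: "continuous_on ?S ?g" by (rule continuous_on_angular_component[OF F])
  show "continuous_on ?S (\<lambda>x. zernike_coeff a n m F * zernike a n m (norm x) (polar_angle x))" if "n \<in> zernike_indices m" for n
    using continuous_on_zernike_fun[OF that, of ?S a] by (intro continuous_intros) (simp only: V)
  show "continuous_on ?S ?g" by (rule gc)
  fix \<epsilon> :: real assume "\<epsilon> > 0"
  then obtain A0 where A0: "finite A0" "A0 \<subseteq> ?I"
    "\<And>A. finite A \<Longrightarrow> A0 \<subseteq> A \<Longrightarrow> A \<subseteq> ?I \<Longrightarrow> L2_norm_on ?S (\<lambda>x. ?g x - proj_on ?S (zernike_fun a) A ?g x) < \<epsilon>"
    using proj_converges[OF compact_cball zernike_orthonormal[OF a] gc zernike_complete[OF a gc]] by metis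
  let ?X = "snd ` (A0 \<inter> {m} \<times> UNIV)"
  show "\<exists>X. finite X \<and> X \<subseteq> zernike_indices m \<and> (\<forall>B. finite B \<and> X \<subseteq> B \<and> B \<subseteq> zernike_indices m \<longrightarrow>
      L2_norm_on ?S (\<lambda>x. ?g x - (\<Sum>n\<in>B. zernike_coeff a n m F * zernike a n m (norm x) (polar_angle x))) < \<epsilon>)"
  proof (intro exI[of _ ?X] conjI allI impI)
    fix B assume "finite B \<and> ?X \<subseteq> B \<and> B \<subseteq> zernike_indices m"
    then have B: "finite B" "?X \<subseteq> B" "B \<subseteq> zernike_indices m" by auto
    \<comment> \<open>On this set the full projection of the component is the partial sum over \<open>B\<close>.\<close>
    define A where "A = A0 \<union> Pair m ` B"
    have A: "finite A" "A0 \<subseteq> A" "A \<subseteq> ?I" using A0 B by (auto simp: A_def)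
    have "proj_on ?S (zernike_fun a) A ?g x = (\<Sum>n\<in>B. zernike_coeff a n m F * zernike a n m (norm x) (polar_angle x))" for x
    proof -
      have "proj_on ?S (zernike_fun a) A ?g x
          = (\<Sum>i\<in>Pair m ` B. inner_on ?S ?g (zernike_fun a i) * zernike_fun a i x)"
        unfolding proj_on_def
      proof (rule sum.mono_neutral_right)
        show "\<forall>i\<in>A - Pair m ` B. inner_on ?S ?g (zernike_fun a i) * zernike_fun a i x = 0"
        proof
          fix i assume i: "i \<in> A - Pair m ` B"
          obtain m' n where mn: "i = (m', n)" by (cases i)
          have "n \<in> zernike_indices m'" using i A mn by auto
          moreover have "m' \<noteq> m" using i B(2) unfolding mn A_def by force
          ultimately show "inner_on ?S ?g (zernike_fun a i) * zernike_fun a i x = 0"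
            using inner_on_angular_component[OF F] by (simp add: mn)
        qed
      qed (use A in \<open>auto simp: A_def\<close>)
      also have "\<dots> = (\<Sum>n\<in>B. inner_on ?S ?g (zernike_fun a (m, n)) * zernike_fun a (m, n) x)"
        by (subst sum.reindex) (auto simp: inj_on_def)
      also have "\<dots> = (\<Sum>n\<in>B. zernike_coeff a n m F * zernike a n m (norm x) (polar_angle x))"
      proof (intro sum.cong refl)
        fix n assume "n \<in> B"
        then have n: "n \<in> zernike_indices m" using B(3) by auto
        have "inner_on ?S ?g (zernike_fun a (m, n)) = zernike_coeff a n m F"
          by (simp add: inner_on_angular_component[OF F n] zernike_coeff_eq_inner_on[OF a n F])
        then show "inner_on ?S ?g (zernike_fun a (m, n)) * zernike_fun a (m, n) x
            = zernike_coeff a n m F * zernike a n m (norm x) (polar_angle x)"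
          by (simp only:) (simp add: zernike_fun_def)
      qed
      finally show ?thesis .
    qed
    then show "L2_norm_on ?S (\<lambda>x. ?g x - (\<Sum>n\<in>B. zernike_coeff a n m F * zernike a n m (norm x) (polar_angle x))) < \<epsilon>"
      using A0(3)[OF A] by simp
  qed (use A0 in auto)
qed simp

text \<open>
  If \<open>M\<close> contains all \<open>m\<close> occurring in \<open>A0\<close>, then subtracting the components with \<open>m \<in> M\<close>
  kills every coefficient that the projection onto \<open>A0\<close> kills and alters no other one
  except by killing it.
\<close>

lemma zernike_outer_sum:
  assumes a: "a > 0" and F: "continuous_on (cball 0 a) F"
  shows "has_L2_sum (cball 0 a) (\<lambda>m. angular_component m F) UNIV F"
proof (rule has_L2_sumI)
  let ?S = "cball (0 :: real \<times> real) a" and ?I = "SIGMA m:UNIV. zernike_indices m"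
  have gc: "continuous_on ?S (angular_component m F)" for m by (rule continuous_on_angular_component[OF F])
  show "continuous_on ?S (angular_component m F)" for m by (rule gc)
  note on = zernike_orthonormal[OF a]
  fix \<epsilon> :: real assume "\<epsilon> > 0"
  then obtain A0 where A0: "finite A0" "A0 \<subseteq> ?I"
    "\<And>A. finite A \<Longrightarrow> A0 \<subseteq> A \<Longrightarrow> A \<subseteq> ?I \<Longrightarrow> L2_norm_on ?S (\<lambda>x. F x - proj_on ?S (zernike_fun a) A F x) < \<epsilon>"
    using proj_converges[OF compact_cball on F zernike_complete[OF a F]] by metis
  show "\<exists>X. finite X \<and> X \<subseteq> UNIV \<and> (\<forall>A. finite A \<and> X \<subseteq> A \<and> A \<subseteq> UNIV \<longrightarrow>
      L2_norm_on ?S (\<lambda>x. F x - (\<Sum>m\<in>A. angular_component m F x)) < \<epsilon>)"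
  proof (intro exI[of _ "fst ` A0"] conjI allI impI)
    fix M :: "int set" assume "finite M \<and> fst ` A0 \<subseteq> M \<and> M \<subseteq> UNIV"
    then have M: "finite M" "fst ` A0 \<subseteq> M" by auto
    let ?H = "\<lambda>x. F x - (\<Sum>m\<in>M. angular_component m F x)"
    let ?K = "\<lambda>x. F x - proj_on ?S (zernike_fun a) A0 F x"
    have sc: "continuous_on ?S (\<lambda>x. \<Sum>m\<in>M. angular_component m F x)" by (intro continuous_intros gc)
    have Hc: "continuous_on ?S ?H" by (intro continuous_intros F gc)
    have pc: "continuous_on ?S (proj_on ?S (zernike_fun a) A0 F)"
      by (rule continuous_on_proj[OF compact_cball on A0(2)])
    have Kc: "continuous_on ?S ?K" by (intro continuous_intros F pc)
    have "L2_norm_on ?S ?H \<le> L2_norm_on ?S ?K"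
    proof (rule L2_norm_le_by_coefficients[OF compact_cball on Hc zernike_complete[OF a Hc] Kc])
      fix i assume "i \<in> ?I"
      then obtain m n where i: "i = (m, n)" "n \<in> zernike_indices m" by auto
      let ?V = "zernike_fun a i"
      have Vc: "continuous_on ?S ?V" unfolding i by (rule continuous_on_zernike_fun[OF i(2)])
      have "inner_on ?S ?H ?V = inner_on ?S F ?V - (\<Sum>m'\<in>M. inner_on ?S (angular_component m' F) ?V)"
        using inner_on_diff_left[OF compact_cball F sc Vc] inner_on_sum_left[OF compact_cball _ Vc, of M "\<lambda>m. angular_component m F"] gc by simp
      also have "(\<Sum>m'\<in>M. inner_on ?S (angular_component m' F) ?V) = (\<Sum>m'\<in>M. if m' = m then inner_on ?S F ?V else 0)"
        unfolding i by (simp only: inner_on_angular_component[OF F i(2)])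
      also have "\<dots> = (if m \<in> M then inner_on ?S F ?V else 0)" using M(1) by simp
      finally have H: "inner_on ?S ?H ?V = inner_on ?S F ?V - (if m \<in> M then inner_on ?S F ?V else 0)" .
      have K: "inner_on ?S ?K ?V = inner_on ?S F ?V - (if i \<in> A0 then inner_on ?S F ?V else 0)"
        using inner_on_diff_left[OF compact_cball F pc Vc] inner_on_proj[OF compact_cball on A0(1,2) \<open>i \<in> ?I\<close>, of F] by simp
      have "i \<in> A0 \<Longrightarrow> m \<in> M" using M(2) i by force
      then show "cmod (inner_on ?S ?H ?V) \<le> cmod (inner_on ?S ?K ?V)" unfolding H K by auto
    qed
    then show "L2_norm_on ?S ?H < \<epsilon>" using A0(3)[OF A0(1) order_refl A0(2)] by simp
  qed (use A0 in auto)
qed (use F in auto)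

lemma L2_norm_on_mono_set:
  assumes "compact T" "S \<subseteq> T" "compact S" "continuous_on T f"
  shows "L2_norm_on S f \<le> L2_norm_on T f"
proof -
  have "continuous_on S f" using assms continuous_on_subset by blast
  then have "(LBINT x:S. (cmod (f x))\<^sup>2) \<le> (LBINT x:T. (cmod (f x))\<^sup>2)"
    unfolding set_lebesgue_integral_def using assms
    by (intro integral_mono borel_integrable_compact continuous_intros) (auto simp: indicator_def)
  then show ?thesis unfolding L2_norm_on_def by (rule real_sqrt_le_mono)
qed

lemma disc_subset_square: "cball 0 a \<subseteq> square a"
proof
  fix x :: "real \<times> real" assume "x \<in> cball 0 a"
  then have "norm (fst x) \<le> a" "norm (snd x) \<le> a"
    using norm_fst_le[of "fst x" "snd x"] norm_snd_le[of "snd x" "fst x"] by auto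
  then show "x \<in> square a" by (cases x) (auto simp: square_def abs_le_iff)
qed

text \<open>
  The coefficient is an inner product with a unit vector on the disc, so by Bessel it
  changes by at most the \<open>L\<^sup>2\<close> distance over the disc, and hence over the square, when \<open>F\<close>
  is replaced by a partial sum of its Fourier series.
\<close>

lemma zernike_coeff_fourier_sum:
  assumes a: "a > 0" and F: "continuous_on UNIV F" and F0: "\<And>x. norm x \<ge> a \<Longrightarrow> F x = 0"
    and n: "n \<in> zernike_indices m"
  shows "((\<lambda>k. conv_weight a k n m *
            (LBINT x. F x * cnj (plane_wave (pi / a * real_of_int (fst k)) (pi / a * real_of_int (snd k)) x)))
          has_sum zernike_coeff a n m F) UNIV"
  unfolding has_sum_def tendsto_iff eventually_finite_subsets_at_top
proof (intro allI impI)
  fix \<epsilon> :: real assume "\<epsilon> > 0"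
  let ?D = "cball (0 :: real \<times> real) a" and ?Q = "square a" and ?V = "zernike_fun a (m, n)" and ?e = "fourier_fun a"
  let ?w = "\<lambda>k. plane_wave (pi / a * real_of_int (fst k)) (pi / a * real_of_int (snd k))"
  have Fc: "continuous_on U F" for U using F continuous_on_subset by blast
  have Vc: "continuous_on U ?V" for U by (rule continuous_on_zernike_fun[OF n])
  have ap: "approximable_on ?Q (range ?e) F"
  proof (rule fourier_complete[OF a Fc])
    have "a \<le> norm (x, y)" if "\<bar>x\<bar> = a \<or> \<bar>y\<bar> = a" for x y :: real
      using that norm_fst_le[of x y] norm_snd_le[of y x] by auto
    then show "F (x, - a) = F (x, a)" "F (- a, y) = F (a, y)" for x y
      using a by (simp_all add: F0)
  qed
  obtain A0 where A0: "finite A0"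
    "\<And>A. finite A \<Longrightarrow> A0 \<subseteq> A \<Longrightarrow> L2_norm_on ?Q (\<lambda>x. F x - proj_on ?Q ?e A F x) < \<epsilon>"
    using proj_converges[OF compact_square fourier_orthonormal[OF a] Fc ap \<open>\<epsilon> > 0\<close>] by (metis subset_UNIV)
  show "\<exists>X. finite X \<and> X \<subseteq> UNIV \<and> (\<forall>A. finite A \<and> X \<subseteq> A \<and> A \<subseteq> UNIV \<longrightarrow>
      dist (\<Sum>k\<in>A. conv_weight a k n m * (LBINT x. F x * cnj (?w k x))) (zernike_coeff a n m F) < \<epsilon>)"
  proof (intro exI[of _ A0] conjI allI impI)
    fix A assume "finite A \<and> A0 \<subseteq> A \<and> A \<subseteq> UNIV"
    then have A: "finite A" "A0 \<subseteq> A" by auto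
    let ?P = "proj_on ?Q ?e A F"
    have Pc: "continuous_on U ?P" for U unfolding proj_on_def by (intro continuous_intros)
    have coeff: "inner_on ?Q F (?e k) = of_real (1 / (2 * a)) * (LBINT x. F x * cnj (?w k x))" for k
    proof -
      have "F x = 0" if "x \<notin> ?Q" for x 
      proof (rule F0)
        have "x \<notin> cball 0 a" using that disc_subset_square[of a] by blast
        then show "norm x \<ge> a" by simp
      qed
      then have "inner_on ?Q F (?e k) = (LBINT x. of_real (1 / (2 * a)) * (F x * cnj (?w k x)))"
        unfolding inner_on_def set_lebesgue_integral_def fourier_fun_def
        by (intro Bochner_Integration.integral_cong) (auto simp: indicator_def)
      then show ?thesis by simp
    qed
    have "inner_on ?D ?P ?V = (\<Sum>k\<in>A. conv_weight a k n m * (LBINT x. F x * cnj (?w k x)))"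
    proof -
      have "inner_on ?D ?P ?V = (\<Sum>k\<in>A. inner_on ?Q F (?e k) * inner_on ?D (?e k) ?V)"
        unfolding proj_on_def
        by (subst inner_on_sum_left) (auto simp: inner_on_scale_left intro!: continuous_intros Vc)
      also have "\<dots> = (\<Sum>k\<in>A. conv_weight a k n m * (LBINT x. F x * cnj (?w k x)))"
      proof (intro sum.cong refl)
        fix k
        have "inner_on ?D (?e k) ?V = of_real (1 / (2 * a)) * (of_real (4 * a\<^sup>2) * conv_weight a k n m)"
          unfolding fourier_fun_def inner_on_scale_left plane_wave_zernike[OF a n] ..
        moreover have "complex_of_real (1 / (2 * a)) * (of_real (1 / (2 * a)) * of_real (4 * a\<^sup>2)) = 1"
          using a by (simp add: power2_eq_square)
        ultimately show "inner_on ?Q F (?e k) * inner_on ?D (?e k) ?V = conv_weight a k n m * (LBINT x. F x * cnj (?w k x))"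
          using a unfolding coeff by (simp add: mult_ac power2_eq_square)
      qed
      finally show ?thesis .
    qed
    moreover have "cmod (inner_on ?D F ?V - inner_on ?D ?P ?V) < \<epsilon>"
    proof -
      let ?d = "\<lambda>x. F x - ?P x"
      have dc: "continuous_on U ?d" for U by (intro continuous_intros Fc Pc)
      have "inner_on ?D F ?V - inner_on ?D ?P ?V = inner_on ?D ?d ?V"
        by (rule inner_on_diff_left[OF compact_cball Fc Pc Vc, symmetric])
      moreover have "(cmod (inner_on ?D ?d ?V))\<^sup>2 \<le> (L2_norm_on ?D ?d)\<^sup>2"
        using Bessel[OF compact_cball zernike_orthonormal[OF a], of "{(m, n)}" ?d] dc n by simp
      then have "cmod (inner_on ?D ?d ?V) \<le> L2_norm_on ?D ?d"
        by (rule power2_le_imp_le[OF _ L2_norm_on_nonneg])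
      also have "\<dots> \<le> L2_norm_on ?Q ?d"
        by (intro L2_norm_on_mono_set compact_square compact_cball disc_subset_square dc)
      also have "\<dots> < \<epsilon>" by (rule A0(2)[OF A])
      ultimately show ?thesis by simp
    qed
    ultimately show "dist (\<Sum>k\<in>A. conv_weight a k n m * (LBINT x. F x * cnj (?w k x))) (zernike_coeff a n m F) < \<epsilon>"
      by (simp add: zernike_coeff_eq_inner_on[OF a n Fc] dist_norm norm_minus_commute)
  qed (use A0 in auto)
qed

theorem corollary4p6:
  fixes a b :: real and f\<^sub>1 f\<^sub>2 :: "real \<times> real \<Rightarrow> complex"
  assumes "a > 0" and "b = a / 2"
    and "continuous_on UNIV f\<^sub>1" and "integrable lborel f\<^sub>1"
    and "continuous_on UNIV f\<^sub>2" and "integrable lborel f\<^sub>2"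
  shows "(\<exists>g :: int \<Rightarrow> real \<times> real \<Rightarrow> complex.
            (\<forall>m. has_L2_sum (cball 0 a)
                   (\<lambda>n x. zernike_coeff a n m (windowed_convolution b f\<^sub>1 f\<^sub>2)
                            * zernike a n m (norm x) (polar_angle x))
                   (zernike_indices m) (g m)) \<and>
            has_L2_sum (cball 0 a) g UNIV (windowed_convolution b f\<^sub>1 f\<^sub>2))
       \<and> (\<forall>m. \<forall>n\<in>zernike_indices m.
            ((\<lambda>k. conv_weight a k n m * disc_fourier_coeff a b f\<^sub>1 k * disc_fourier_coeff a b f\<^sub>2 k)
              has_sum zernike_coeff a n m (windowed_convolution b f\<^sub>1 f\<^sub>2)) UNIV)"
proof -
  let ?F = "windowed_convolution b f\<^sub>1 f\<^sub>2"
  have b: "b > 0" and ab: "2 * b = a" using assms(1,2) by auto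
  have F: "continuous_on UNIV ?F" by (rule continuous_windowed_convolution[OF assms(3,5)])
  then have Fc: "continuous_on (cball 0 a) ?F" using continuous_on_subset by blast
  have F0: "?F x = 0" if "norm x \<ge> a" for x
    using windowed_convolution_boundary[OF assms(3,5)] that by (simp add: ab)
  show ?thesis
  proof (intro conjI exI[of _ "\<lambda>m. angular_component m ?F"] allI ballI)
    fix m n assume "n \<in> zernike_indices m"
    from zernike_coeff_fourier_sum[OF assms(1) F F0 this]
    show "((\<lambda>k. conv_weight a k n m * disc_fourier_coeff a b f\<^sub>1 k * disc_fourier_coeff a b f\<^sub>2 k)
        has_sum zernike_coeff a n m ?F) UNIV"
      unfolding convolution_theorem[OF b assms(3,5)] by (simp only: mult.assoc)
  qed (intro zernike_inner_sum zernike_outer_sum assms(1) Fc)+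
qed

end
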